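(* Let $\alpha\in(0,1]$ and $\gamma\in(0,\pi/2]$. If $f\in\mathcal{F}[A,B]$, then: (i) For $A=-B=\alpha$, $f$ is starlike univalent in the disc $|z|<r_0$, where $$r_0=\frac{\exp(2\alpha)-1}{\alpha(\exp(2\alpha)+1)}.$$ (ii) For $A=\alpha e^{i\gamma}$ and $B=\alpha e^{-i\gamma}$, $f\in\mathcal{S}^*$ whenever $\gamma\in(\gamma',\pi/2)$, and $f$ is starlike univalent in the disc $|z|<r_0$ whenever $\gamma\in(0,\gamma_0)\cup(\gamma_0,\gamma']$, where $r_0$ is the smallest positive root $r$ of $$\tan(2\alpha\sin\gamma)+\frac{\alpha^4r^4\sin 2\gamma+2\alpha^3r^3\sin\gamma\cos 2\gamma-\alpha^2r^2\sin 2\gamma-2\alpha r\sin\gamma}{\alpha^4r^4\cos 2\gamma-2\alpha^3r^3\sin\gamma\sin 2\gamma-\alpha^2r^2\cos 2\gamma-\alpha^2r^2+1}=0.$$ The result is sharp.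
   Context: $\mathbb{D}=\{z\in\mathbb{C}:|z|<1\}$; $\mathcal{A}$ is the class of analytic functions $f$ on $\mathbb{D}$ with $f(z)=z+a_2z^2+a_3z^3+\cdots$. For analytic $f,g$ on $\mathbb{D}$, $f\prec g$ means $f=g\circ\omega$ for some Schwarz function $\omega$ (analytic on $\mathbb{D}$, $\omega(0)=0$, $|\omega|<1$). $\mathcal{S}^*$ is the class of univalent $f\in\mathcal{A}$ with $zf'(z)/f(z)\prec(1+z)/(1-z)$ (starlike functions). $f$ is starlike univalent in $|z|<\rho$ if $\operatorname{Re}(zf'(z)/f(z))>0$ for $|z|<\rho$ (so that $f$ is univalent there with image starlike with respect to the origin). For $0<\alpha\le1$, and either $A=-B=\alpha$, or $A=\alpha e^{i\gamma}$, $B=\alpha e^{-i\gamma}$ with $0<\gamma\le\pi/2$, define $$\psi_{A,B}(z)=\frac{1}{A-B}\log\left(\frac{1+Az}{1+Bz}\right),\quad z\in\mathbb{D},$$ with the branch satisfying $\psi_{A,B}(0)=0$, and $$\mathcal{F}[A,B]=\left\{f\in\mathcal{A}:\ \frac{zf'(z)}{f(z)}-1\prec\psi_{A,B}(z)\right\}.$$ Let $$g(\alpha,\gamma)=1+\frac{1}{2\alpha\sin\gamma}\left(\tan^{-1}\left(\frac{\alpha^2\sin2\gamma}{\alpha^2\cos2\gamma-1}\right)-\sin^{-1}\left(\frac{2\alpha\sin\gamma}{\sqrt{1+\alpha^4-2\alpha^2\cos2\gamma}}\right)\right).$$ $\gamma_0\simeq1.2461\ldots$ is the zero in $(0,\pi/2)$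 of $g(1,\gamma)=1+\dfrac{\gamma-\pi}{2\sin\gamma}$, and $\gamma'$ (depending on $\alpha$) is the unique number in $(\gamma_0,\pi/2)$ with $g(\alpha,\gamma')=0$.
   Formalization: For α=1 no γ' in (γ₀,π/2) with g(1,γ')=0 exists, so γ' is taken to be γ₀ there (the second interval is then empty); where 2α sin γ=π/2, so that the tangent is undefined, the radius equation is read as the vanishing of the denominator. *)

theory Defs
  imports "HOL-Complex_Analysis.Complex_Analysis"
begin

abbreviation unit_disc :: "complex set" where
  "unit_disc \<equiv> ball 0 1"

definition class_A :: "(complex \<Rightarrow> complex) set" where
  "class_A = {f. f holomorphic_on unit_disc \<and> f 0 = 0 \<and> deriv f 0 = 1}"

definition schwarz_function :: "(complex \<Rightarrow> complex) \<Rightarrow> bool" where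
  "schwarz_function w \<longleftrightarrow>
     w holomorphic_on unit_disc \<and> w 0 = 0 \<and> (\<forall>z\<in>unit_disc. norm (w z) < 1)"

definition subordinate :: "(complex \<Rightarrow> complex) \<Rightarrow> (complex \<Rightarrow> complex) \<Rightarrow> bool"
    (infix "\<prec>\<^sub>D" 50) where
  "f \<prec>\<^sub>D g \<longleftrightarrow>
     f holomorphic_on unit_disc \<and> g holomorphic_on unit_disc \<and>
     (\<exists>w. schwarz_function w \<and> (\<forall>z\<in>unit_disc. f z = g (w z)))"

(* The quotient z f'(z) / f(z), with its removable singularity at the origin filled in:
   for f in class A the value there is 1. *)
definition zfpf :: "(complex \<Rightarrow> complex) \<Rightarrow> complex \<Rightarrow> complex" where
  "zfpf f z = (if z = 0 then 1 else z * deriv f z / f z)"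

definition starlike_class :: "(complex \<Rightarrow> complex) set" where
  "starlike_class =
     {f \<in> class_A. inj_on f unit_disc \<and> zfpf f \<prec>\<^sub>D (\<lambda>z. (1 + z) / (1 - z))}"

(* If f has a zero z other than 0, then x / 0 = 0 gives zfpf f z = 0, so the condition
   below excludes such zeros from the disc. *)
definition starlike_univalent_in :: "(complex \<Rightarrow> complex) \<Rightarrow> real \<Rightarrow> bool" where
  "starlike_univalent_in f \<rho> \<longleftrightarrow> (\<forall>z. norm z < \<rho> \<longrightarrow> 0 < Re (zfpf f z))"

(* For |A|, |B| \<le> 1 and |z| < 1 both 1 + A z and 1 + B z lie in the open right half-plane,
   so their quotient avoids the nonpositive reals and the principal logarithm Ln is the
   holomorphic branch vanishing at z = 0. *)
definition psi :: "complex \<Rightarrow> complex \<Rightarrow> complex \<Rightarrow> complex" where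
  "psi A B z = 1 / (A - B) * Ln ((1 + A * z) / (1 + B * z))"

definition class_F :: "complex \<Rightarrow> complex \<Rightarrow> (complex \<Rightarrow> complex) set" where
  "class_F A B = {f \<in> class_A. (\<lambda>z. zfpf f z - 1) \<prec>\<^sub>D psi A B}"

definition g_fun :: "real \<Rightarrow> real \<Rightarrow> real" where
  "g_fun \<alpha> \<gamma> =
     1 + 1 / (2 * \<alpha> * sin \<gamma>) *
       (arctan (\<alpha>\<^sup>2 * sin (2 * \<gamma>) / (\<alpha>\<^sup>2 * cos (2 * \<gamma>) - 1))
        - arcsin (2 * \<alpha> * sin \<gamma> / sqrt (1 + \<alpha> ^ 4 - 2 * \<alpha>\<^sup>2 * cos (2 * \<gamma>))))"

(* g_fun 1 \<gamma> = 1 + (\<gamma> - pi) / (2 * sin \<gamma>) on this interval; the zero is 1.2461... *)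
definition gamma0 :: real where
  "gamma0 = (THE \<gamma>. 0 < \<gamma> \<and> \<gamma> < pi / 2 \<and> g_fun 1 \<gamma> = 0)"

(* For \<alpha> = 1 the only zero of g_fun 1 in (0, pi/2) is gamma0 itself, so the open interval
   (gamma0, pi/2) contains none; gamma0 is the limiting value as \<alpha> tends to 1. *)
definition gamma' :: "real \<Rightarrow> real" where
  "gamma' \<alpha> =
     (if \<alpha> = 1 then gamma0
      else (THE \<gamma>. gamma0 < \<gamma> \<and> \<gamma> < pi / 2 \<and> g_fun \<alpha> \<gamma> = 0))"

(* With D the denominator and N the numerator, D + i N equals
   (1 - x^2 exp(2 i \<gamma>)) (1 - x^2 - 2 i x sin \<gamma>) for x = \<alpha> r, so N / D is a tangent.
   If 2 \<alpha> sin \<gamma> = pi/2, then tan has a pole and the equation means that N / D has one too,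
   i.e. D = 0. The conventions tan (pi/2) = 0 and x / 0 = 0 agree with this: such a point r
   satisfies the equation, and when 2 \<alpha> sin \<gamma> < pi is not pi/2, no r with D = 0 does. *)
definition radius_equation :: "real \<Rightarrow> real \<Rightarrow> real \<Rightarrow> bool" where
  "radius_equation \<alpha> \<gamma> r \<longleftrightarrow>
     tan (2 * \<alpha> * sin \<gamma>) +
       (\<alpha> ^ 4 * r ^ 4 * sin (2 * \<gamma>) + 2 * \<alpha> ^ 3 * r ^ 3 * sin \<gamma> * cos (2 * \<gamma>)
          - \<alpha>\<^sup>2 * r\<^sup>2 * sin (2 * \<gamma>) - 2 * \<alpha> * r * sin \<gamma>) /
       (\<alpha> ^ 4 * r ^ 4 * cos (2 * \<gamma>) - 2 * \<alpha> ^ 3 * r ^ 3 * sin \<gamma> * sin (2 * \<gamma>)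
          - \<alpha>\<^sup>2 * r\<^sup>2 * cos (2 * \<gamma>) - \<alpha>\<^sup>2 * r\<^sup>2 + 1) = 0"

definition smallest_positive_root :: "(real \<Rightarrow> bool) \<Rightarrow> real \<Rightarrow> bool" where
  "smallest_positive_root P r \<longleftrightarrow> 0 < r \<and> P r \<and> (\<forall>s. 0 < s \<and> P s \<longrightarrow> r \<le> s)"

(* The radius \<rho> ranges up to 1 only, since members of class_F are arbitrary outside the unit
   disc. A single f serves for all \<rho>. *)
definition radius_sharp :: "(complex \<Rightarrow> complex) set \<Rightarrow> real \<Rightarrow> bool" where
  "radius_sharp F r0 \<longleftrightarrow>
     (\<exists>f\<in>F. \<forall>\<rho>. r0 < \<rho> \<and> \<rho> \<le> 1 \<longrightarrow> \<not> starlike_univalent_in f \<rho>)"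

end

(* Writing s = sin gamma and x = alpha r, the real part of psi on |z| <= r is smallest at z = -r,
   where it equals -2 arg(1 - x exp(-i gamma)) / (2 alpha s). So f is starlike in |z| < r as long as
   arctan (x s / (1 - x cos gamma)) <= alpha s, which can be solved for x in closed form,
   x = sin (alpha s) / sin (alpha s + gamma); the radius equation is the doubled-angle form of
   the corresponding equality, because (1 - x^2 exp(2 i gamma)) (1 - x^2 - 2 i x s) is
   |1 + x exp(i gamma)|^2 (1 - x exp(i gamma))^2.
   The same identity gives g_fun = 1 - arctan (alpha s / (1 - alpha cos gamma)) / (alpha s), whose sign
   changes exactly once in gamma by a derivative computation; this is the threshold gamma'.
   Equality holds for z f'(z) / f(z) = 1 + psi(z). *)
theory Submission
  imports Defs
begin

text \<open>Membership in \<open>starlike_class\<close> includes univalence, so a positive real part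
  of \<open>zfpf f\<close> does not settle it; injectivity is derived from that positivity by local
  inverses and compactness. The threshold is delicate because the excess is not monotone in gamma:
  for alpha < 1 it rises from 0 at gamma = 0 and then falls to a negative value at pi/2. What
  survives is that it can change sign only downwards, which a quadratic in cos gamma decides. That
  the zero lies above \<open>gamma0\<close> is a separate matter, settled by fixing the angle
  \<open>gamma0\<close> and varying alpha. Doubling the angle loses information, so the radius
  equation may have roots other than the wanted one. Only smaller ones must be excluded, and in that
  range the doubled tangent is still injective. Sharpness needs a function with prescribed
  \<open>zfpf\<close>, which is obtained by integrating a logarithmic derivative.\<close>

subsection \<open>The threshold angle\<close>

lemma arctan_less_self:
  fixes x :: real
  assumes "0 < x"
  shows "arctan x < x"
proof -
  have "0 - arctan 0 < x - arctan x"
  proof (rule DERIV_pos_imp_increasing_open[OF assms])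
    fix t :: real
    assume "0 < t" "t < x"
    have "((\<lambda>t. t - arctan t) has_real_derivative 1 - inverse (1 + t\<^sup>2)) (at t)"
      by (auto intro!: derivative_eq_intros)
    moreover have "inverse (1 + t\<^sup>2) < 1"
      using \<open>0 < t\<close> by (simp add: inverse_less_1_iff)
    ultimately show "\<exists>y. ((\<lambda>t. t - arctan t) has_real_derivative y) (at t) \<and> 0 < y"
      by force
  qed (auto intro!: continuous_intros)
  then show ?thesis by simp
qed

text \<open>Half of the amount by which \<open>- Arg ((1 + A z) / (1 + B z))\<close> at \<open>z = - 1\<close> exceeds
  \<open>\<bar>A - B\<bar> = 2 \<alpha> sin \<gamma>\<close>; a nonpositive value means that \<open>Re (1 + \<psi>)\<close> is nonnegative there.\<close>

definition excess :: "real \<Rightarrow> real \<Rightarrow> real" where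
  "excess \<alpha> \<gamma> = arctan (\<alpha> * sin \<gamma> / (1 - \<alpha> * cos \<gamma>)) - \<alpha> * sin \<gamma>"

lemma mult_cos_less_1:
  fixes \<alpha> \<gamma> :: real
  assumes "0 \<le> \<alpha>" "\<alpha> \<le> 1" "0 < \<gamma>" "\<gamma> \<le> pi"
  shows "\<alpha> * cos \<gamma> < 1"
proof -
  have "cos \<gamma> < 1"
    using cos_monotone_0_pi[of 0 \<gamma>] assms by simp
  moreover from this have "\<alpha> * cos \<gamma> \<le> \<alpha> * 1"
    using assms by (intro mult_left_mono) auto
  ultimately show ?thesis using assms by (cases "\<alpha> = 1") auto
qed

lemma norm_1_minus_polar:
  "(1 - \<alpha> * cos \<gamma>)\<^sup>2 + (\<alpha> * sin \<gamma>)\<^sup>2 = 1 + \<alpha>\<^sup>2 - 2 * \<alpha> * cos (\<gamma>::real)"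
  unfolding power_mult_distrib sin_squared_eq by (simp add: power2_eq_square algebra_simps)

text \<open>The denominator is the squared modulus of 1 - alpha exp(i gamma). The factored numerator
  reduces the sign to the quadratic 2 c^2 - alpha c - 1 in c = cos gamma; its roots have product
  -1/2, so exactly one is positive.\<close>

lemma excess_deriv_gamma:
  assumes "\<alpha> * cos \<gamma> < 1"
  shows "(excess \<alpha> has_real_derivative
    \<alpha>\<^sup>2 * (2 * (cos \<gamma>)\<^sup>2 - \<alpha> * cos \<gamma> - 1) / ((1 - \<alpha> * cos \<gamma>)\<^sup>2 + (\<alpha> * sin \<gamma>)\<^sup>2)) (at \<gamma>)"
proof -
  define p q where "p = 1 - \<alpha> * cos \<gamma>" and "q = \<alpha> * sin \<gamma>"
  have p: "p > 0" using assms by (simp add: p_def)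
  have pq: "p\<^sup>2 + q\<^sup>2 > 0" using p by (simp add: sum_power2_gt_zero_iff)
  have inv: "inverse (1 + (q / p)\<^sup>2) = p * p / (p\<^sup>2 + q\<^sup>2)"
    using p pq by (simp add: field_simps power2_eq_square)
  have Q: "p\<^sup>2 + q\<^sup>2 = 1 + \<alpha>\<^sup>2 - 2 * \<alpha> * cos \<gamma>"
    unfolding p_def q_def by (rule norm_1_minus_polar)
  have "(excess \<alpha> has_real_derivative
      inverse (1 + (q / p)\<^sup>2) * ((\<alpha> * cos \<gamma> * p - q * q) / (p * p)) - \<alpha> * cos \<gamma>) (at \<gamma>)"
    unfolding excess_def p_def q_def
    by (rule derivative_eq_intros refl | use assms in \<open>simp add: field_simps; fail\<close>)+
  also have "inverse (1 + (q / p)\<^sup>2) * ((\<alpha> * cos \<gamma> * p - q * q) / (p * p))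
      = (\<alpha> * cos \<gamma> * p - q * q) / (p\<^sup>2 + q\<^sup>2)"
    using p unfolding inv by simp
  also have "\<alpha> * cos \<gamma> * p - q * q = \<alpha> * cos \<gamma> - \<alpha>\<^sup>2"
  proof -
    have "\<alpha> * cos \<gamma> * p - q * q = \<alpha> * cos \<gamma> - \<alpha>\<^sup>2 * (cos \<gamma>)\<^sup>2 - \<alpha>\<^sup>2 * (sin \<gamma>)\<^sup>2"
      unfolding p_def q_def by (simp add: power2_eq_square algebra_simps)
    then show ?thesis unfolding sin_squared_eq by (simp add: algebra_simps)
  qed
  also have "(\<alpha> * cos \<gamma> - \<alpha>\<^sup>2) / (p\<^sup>2 + q\<^sup>2) - \<alpha> * cos \<gamma>
      = (\<alpha> * cos \<gamma> - \<alpha>\<^sup>2 - \<alpha> * cos \<gamma> * (1 + \<alpha>\<^sup>2 - 2 * \<alpha> * cos \<gamma>)) / (p\<^sup>2 + q\<^sup>2)"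
    unfolding Q[symmetric] using pq by (auto simp: diff_divide_distrib)
  also have "\<alpha> * cos \<gamma> - \<alpha>\<^sup>2 - \<alpha> * cos \<gamma> * (1 + \<alpha>\<^sup>2 - 2 * \<alpha> * cos \<gamma>)
      = \<alpha>\<^sup>2 * (2 * (cos \<gamma>)\<^sup>2 - \<alpha> * cos \<gamma> - 1)"
    by (simp add: power2_eq_square algebra_simps)
  finally show ?thesis unfolding p_def q_def .
qed

text \<open>For a fixed acute angle the sign is that of 2 cos gamma - alpha, so on alpha > 0 the
  excess first rises and then falls.\<close>

lemma excess_deriv_alpha:
  assumes "\<alpha> * cos \<gamma> < 1"
  shows "((\<lambda>\<alpha>. excess \<alpha> \<gamma>) has_real_derivative
    \<alpha> * sin \<gamma> * (2 * cos \<gamma> - \<alpha>) / ((1 - \<alpha> * cos \<gamma>)\<^sup>2 + (\<alpha> * sin \<gamma>)\<^sup>2)) (at \<alpha>)"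
proof -
  define p q where "p = 1 - \<alpha> * cos \<gamma>" and "q = \<alpha> * sin \<gamma>"
  have p: "p > 0" using assms by (simp add: p_def)
  have pq: "p\<^sup>2 + q\<^sup>2 > 0" using p by (simp add: sum_power2_gt_zero_iff)
  have inv: "inverse (1 + (q / p)\<^sup>2) = p * p / (p\<^sup>2 + q\<^sup>2)"
    using p pq by (simp add: field_simps power2_eq_square)
  have Q: "p\<^sup>2 + q\<^sup>2 = 1 + \<alpha>\<^sup>2 - 2 * \<alpha> * cos \<gamma>"
    unfolding p_def q_def by (rule norm_1_minus_polar)
  have "((\<lambda>\<alpha>. excess \<alpha> \<gamma>) has_real_derivative
      inverse (1 + (q / p)\<^sup>2) * ((sin \<gamma> * p + q * cos \<gamma>) / (p * p)) - sin \<gamma>) (at \<alpha>)"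
    unfolding excess_def p_def q_def
    by (rule derivative_eq_intros refl | use assms in \<open>simp add: field_simps; fail\<close>)+
  also have "inverse (1 + (q / p)\<^sup>2) * ((sin \<gamma> * p + q * cos \<gamma>) / (p * p))
      = (sin \<gamma> * p + q * cos \<gamma>) / (p\<^sup>2 + q\<^sup>2)"
    using p unfolding inv by simp
  also have "sin \<gamma> * p + q * cos \<gamma> = sin \<gamma>"
    by (simp add: p_def q_def algebra_simps)
  also have "sin \<gamma> / (p\<^sup>2 + q\<^sup>2) - sin \<gamma>
      = (sin \<gamma> - sin \<gamma> * (1 + \<alpha>\<^sup>2 - 2 * \<alpha> * cos \<gamma>)) / (p\<^sup>2 + q\<^sup>2)"
    unfolding Q[symmetric] using pq by (auto simp: diff_divide_distrib)
  also have "sin \<gamma> - sin \<gamma> * (1 + \<alpha>\<^sup>2 - 2 * \<alpha> * cos \<gamma>) = \<alpha> * sin \<gamma> * (2 * cos \<gamma> - \<alpha>)"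
    by (simp add: power2_eq_square algebra_simps)
  finally show ?thesis unfolding p_def q_def .
qed

text \<open>Were the quadratic \<open>q\<close> still nonnegative at cos gamma1, it would be
  positive at all smaller angles, and the excess would have grown from its value 0 at angle 0 to
  something positive at gamma1. So \<open>q\<close> is already negative there, remains negative up
  to pi/2, and the excess strictly decreases from gamma1 on.\<close>

lemma excess_crossing:
  assumes \<alpha>: "0 < \<alpha>" "\<alpha> \<le> 1"
    and \<gamma>: "0 < \<gamma>1" "\<gamma>1 < \<gamma>2" "\<gamma>2 \<le> pi / 2"
    and le: "excess \<alpha> \<gamma>1 \<le> 0"
  shows "excess \<alpha> \<gamma>2 < 0"
proof -
  define q where "q c = 2 * c\<^sup>2 - \<alpha> * c - 1" for c
  have cos_1: "\<alpha> * cos t < 1" if "0 < t" "t \<le> pi / 2" for t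
    using mult_cos_less_1[of \<alpha> t] \<alpha> that by simp
  have sq: "0 < (1 - \<alpha> * cos t)\<^sup>2 + (\<alpha> * sin t)\<^sup>2" if "\<alpha> * cos t < 1" for t
    using that by (simp add: sum_power2_gt_zero_iff)
  define D where "D t = \<alpha>\<^sup>2 * q (cos t) / ((1 - \<alpha> * cos t)\<^sup>2 + (\<alpha> * sin t)\<^sup>2)" for t
  have deriv: "(excess \<alpha> has_real_derivative D t) (at t)" if "\<alpha> * cos t < 1" for t
    unfolding q_def D_def by (rule excess_deriv_gamma[OF that])
  have q_mono: "0 < q c" if "0 \<le> q c1" "0 \<le> c1" "c1 < c" for c c1
  proof -
    have c1: "1 \<le> c1 * (2 * c1 - \<alpha>)"
      using that by (simp add: q_def power2_eq_square algebra_simps)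
    have "0 < 2 * c1 - \<alpha>"
    proof (rule ccontr)
      assume "\<not> ?thesis"
      then have "c1 * (2 * c1 - \<alpha>) \<le> 0" using that(2) by (intro mult_nonneg_nonpos) auto
      with c1 show False by simp
    qed
    with that have "c1 * (2 * c1 - \<alpha>) < c * (2 * c - \<alpha>)"
      by (intro mult_strict_mono) auto
    then show ?thesis using c1 by (simp add: q_def power2_eq_square algebra_simps)
  qed
  have cos_pos: "0 < cos \<gamma>1" using \<gamma> by (intro cos_gt_zero) auto
  have neg: "q (cos \<gamma>1) < 0"
  proof (rule ccontr)
    assume "\<not> ?thesis"
    then have q1: "0 \<le> q (cos \<gamma>1)" by simp
    have "cos \<gamma>1 < 1" using cos_monotone_0_pi[of 0 \<gamma>1] \<gamma> by simp
    then have "0 < q 1" using q_mono[OF q1] cos_pos by simp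
    \<comment> \<open>\<open>q 1\<close> is 1 - alpha. Excluding alpha = 1 keeps 1 - alpha cos t
      positive down to t = 0, where the comparison starts.\<close>
    then have "\<alpha> < 1" by (simp add: q_def)
    have lt1: "\<alpha> * cos t < 1" for t
    proof -
      have "\<alpha> * cos t \<le> \<alpha> * 1" using \<alpha> by (intro mult_left_mono) auto
      then show ?thesis using \<open>\<alpha> < 1\<close> by simp
    qed
    have "excess \<alpha> 0 < excess \<alpha> \<gamma>1"
    proof (rule DERIV_pos_imp_increasing_open[OF \<gamma>(1)])
      fix t assume t: "0 < t" "t < \<gamma>1"
      have "cos \<gamma>1 < cos t" using t \<gamma> by (intro cos_monotone_0_pi) auto
      then have "0 < q (cos t)" using q_mono[OF q1] cos_pos by simp
      show "\<exists>y. (excess \<alpha> has_real_derivative y) (at t) \<and> 0 < y"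
        by (intro exI[of _ "D t"] conjI deriv lt1) (use sq[OF lt1] \<alpha> \<open>0 < q (cos t)\<close> in \<open>auto simp: D_def\<close>)
    next
      show "continuous_on {0..\<gamma>1} (excess \<alpha>)"
        using DERIV_isCont[OF deriv[OF lt1]] by (simp add: continuous_at_imp_continuous_on)
    qed
    with le show False by (simp add: excess_def)
  qed
  have "excess \<alpha> \<gamma>2 < excess \<alpha> \<gamma>1"
  proof (rule DERIV_neg_imp_decreasing_open[OF \<gamma>(2)])
    fix t assume t: "\<gamma>1 < t" "t < \<gamma>2"
    have "cos t < cos \<gamma>1" using t \<gamma> by (intro cos_monotone_0_pi) auto
    moreover have "0 < cos t" using t \<gamma> by (intro cos_gt_zero) auto
    ultimately have "q (cos t) < 0" using q_mono[of "cos t" "cos \<gamma>1"] neg by force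
    show "\<exists>y. (excess \<alpha> has_real_derivative y) (at t) \<and> y < 0"
      by (intro exI[of _ "D t"] conjI deriv cos_1)
        (use sq[OF cos_1] \<alpha> t \<gamma> \<open>q (cos t) < 0\<close> in \<open>auto simp: D_def intro!: divide_neg_pos mult_pos_neg\<close>)
  next
    show "continuous_on {\<gamma>1..\<gamma>2} (excess \<alpha>)"
      using DERIV_isCont[OF deriv[OF cos_1]] \<gamma> by (auto intro!: continuous_at_imp_continuous_on)
  qed
  with le show ?thesis by simp
qed

lemma excess_zero_exists:
  assumes \<alpha>: "0 < \<alpha>" "\<alpha> \<le> 1" and \<gamma>: "0 < \<gamma>1" "\<gamma>1 < pi / 2" and pos: "0 < excess \<alpha> \<gamma>1"
  shows "\<exists>\<gamma>. \<gamma>1 < \<gamma> \<and> \<gamma> < pi / 2 \<and> excess \<alpha> \<gamma> = 0"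
proof -
  have end_neg: "excess \<alpha> (pi / 2) < 0"
    using arctan_less_self[OF \<alpha>(1)] by (simp add: excess_def)
  have "\<exists>\<gamma>\<ge>\<gamma>1. \<gamma> \<le> pi / 2 \<and> excess \<alpha> \<gamma> = 0"
  proof (rule IVT2)
    show "\<forall>t. \<gamma>1 \<le> t \<and> t \<le> pi / 2 \<longrightarrow> isCont (excess \<alpha>) t"
      using mult_cos_less_1 \<alpha> \<gamma> by (auto intro!: DERIV_isCont[OF excess_deriv_gamma])
  qed (use end_neg pos \<gamma> in auto)
  then show ?thesis using end_neg pos by (metis less_eq_real_def less_irrefl)
qed

text \<open>With u and v the arguments of 1 - alpha exp(-i gamma) and 1 + alpha exp(i gamma), the
  arcsin term is u + v and the arctan term is v - u, so their difference is -2 u. The square root is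
  the product of the two moduli, |1 - alpha^2 exp(2 i gamma)|.\<close>

lemma g_fun_eq:
  assumes \<alpha>: "0 < \<alpha>" "\<alpha> \<le> 1" and \<gamma>: "0 < \<gamma>" "\<gamma> < pi / 2"
  shows "g_fun \<alpha> \<gamma> = - excess \<alpha> \<gamma> / (\<alpha> * sin \<gamma>)"
proof -
  have s: "0 < sin \<gamma>" using \<gamma> by (intro sin_gt_zero) auto
  have c: "0 < cos \<gamma>" using \<gamma> by (intro cos_gt_zero) auto
  define a p q where "a = \<alpha> * sin \<gamma>" and "p = 1 - \<alpha> * cos \<gamma>" and "q = 1 + \<alpha> * cos \<gamma>"
  have a: "0 < a" using \<alpha> s by (simp add: a_def)
  have p: "0 < p" using mult_cos_less_1[of \<alpha> \<gamma>] \<alpha> \<gamma> by (simp add: p_def)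
  have q: "0 < q" using \<alpha> c by (simp add: q_def add_pos_pos)
  have a2: "a\<^sup>2 = \<alpha>\<^sup>2 - \<alpha>\<^sup>2 * (cos \<gamma>)\<^sup>2"
    unfolding a_def power_mult_distrib sin_squared_eq by (simp add: algebra_simps)
  define u v where "u = arctan (a / p)" and "v = arctan (a / q)"
  have uv: "0 < u" "u < pi / 2" "0 < v" "v < pi / 2"
    using a p q arctan_ubound by (auto simp: u_def v_def)
  have tan_uv: "tan u = a / p" "tan v = a / q" by (auto simp: u_def v_def tan_arctan)
  have a2pq: "a\<^sup>2 \<le> p * q"
  proof -
    have "p * q = 1 - \<alpha>\<^sup>2 * (cos \<gamma>)\<^sup>2"
      by (simp add: p_def q_def power2_eq_square algebra_simps)
    moreover have "\<alpha>\<^sup>2 \<le> 1" using \<alpha> by (simp add: power_le_one)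
    ultimately show ?thesis by (simp add: a2)
  qed
  define P Q where "P = sqrt (p\<^sup>2 + a\<^sup>2)" and "Q = sqrt (q\<^sup>2 + a\<^sup>2)"
  have PQ: "0 < P" "0 < Q" using p q by (auto simp: P_def Q_def sum_power2_gt_zero_iff)
  have hyp: "sqrt (1 + (a / x)\<^sup>2) = sqrt (x\<^sup>2 + a\<^sup>2) / x" if "0 < x" for x
  proof -
    have "sqrt (1 + (a / x)\<^sup>2) = sqrt ((x\<^sup>2 + a\<^sup>2) / x\<^sup>2)"
      using that by (simp add: power_divide add_divide_distrib)
    then show ?thesis using that by (simp add: real_sqrt_divide)
  qed
  have trig: "cos u = p / P" "sin u = a / P" "cos v = q / Q" "sin v = a / Q"
    using p q PQ by (simp_all add: u_def v_def cos_arctan sin_arctan hyp P_def Q_def)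
  have cos_sum: "cos (u + v) = (p * q - a\<^sup>2) / (P * Q)"
    using PQ by (simp add: cos_add trig field_simps power2_eq_square)
  have sin_sum: "sin (u + v) = 2 * a / (P * Q)"
  proof -
    have "sin (u + v) = a * (p + q) / (P * Q)"
      using PQ by (simp add: sin_add trig field_simps)
    also have "p + q = 2" by (simp add: p_def q_def)
    finally show ?thesis by simp
  qed
  \<comment> \<open>Here alpha <= 1 matters: it gives a^2 <= p q, hence an angle sum within the
    range of arcsin.\<close>
  have sum_le: "u + v \<le> pi / 2"
  proof (rule ccontr)
    assume "\<not> ?thesis"
    then have "cos (u + v) < 0" using uv cos_lt_zero_pi[of "u + v"] by auto
    moreover have "0 \<le> cos (u + v)" unfolding cos_sum using a2pq PQ by simp
    ultimately show False by simp
  qed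
  have PQ_eq: "P * Q = sqrt (1 + \<alpha> ^ 4 - 2 * \<alpha>\<^sup>2 * cos (2 * \<gamma>))"
  proof -
    have "(p\<^sup>2 + a\<^sup>2) * (q\<^sup>2 + a\<^sup>2) = 1 + \<alpha> ^ 4 - 2 * \<alpha>\<^sup>2 * cos (2 * \<gamma>)"
      unfolding a2 p_def q_def cos_double_cos by (simp add: power2_eq_square power4_eq_xxxx algebra_simps)
    then show ?thesis by (simp add: P_def Q_def real_sqrt_mult[symmetric])
  qed
  have asin: "arcsin (2 * \<alpha> * sin \<gamma> / sqrt (1 + \<alpha> ^ 4 - 2 * \<alpha>\<^sup>2 * cos (2 * \<gamma>))) = u + v"
    using arcsin_sin[of "u + v"] sum_le uv unfolding sin_sum PQ_eq a_def by (simp add: mult.assoc)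
  have atan: "arctan (\<alpha>\<^sup>2 * sin (2 * \<gamma>) / (\<alpha>\<^sup>2 * cos (2 * \<gamma>) - 1)) = - (u - v)"
  proof -
    have pqa: "p * q + a\<^sup>2 = 1 - \<alpha>\<^sup>2 * cos (2 * \<gamma>)"
      unfolding a2 p_def q_def cos_double_cos by (simp add: power2_eq_square algebra_simps)
    have "0 < cos (u - v)" using uv by (intro cos_gt_zero_pi) auto
    then have "tan (u - v) = (tan u - tan v) / (1 + tan u * tan v)"
      using uv by (intro tan_diff) (auto simp: cos_gt_zero less_imp_neq[symmetric])
    also have "\<dots> = a * (q - p) / (p * q + a\<^sup>2)"
    proof -
      have "1 + a / p * (a / q) = (p * q + a\<^sup>2) / (p * q)"
        using p q by (simp add: field_simps power2_eq_square)
      moreover have "a / p - a / q = a * (q - p) / (p * q)"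
        using p q by (simp add: field_simps)
      ultimately show ?thesis using p q unfolding tan_uv by simp
    qed
    also have "a * (q - p) = \<alpha>\<^sup>2 * sin (2 * \<gamma>)"
      unfolding sin_double by (simp add: a_def q_def p_def power2_eq_square algebra_simps)
    also have "\<alpha>\<^sup>2 * sin (2 * \<gamma>) / (p * q + a\<^sup>2) = - (\<alpha>\<^sup>2 * sin (2 * \<gamma>) / (\<alpha>\<^sup>2 * cos (2 * \<gamma>) - 1))"
      unfolding pqa by (metis minus_diff_eq minus_divide_right)
    finally have "arctan (\<alpha>\<^sup>2 * sin (2 * \<gamma>) / (\<alpha>\<^sup>2 * cos (2 * \<gamma>) - 1)) = - arctan (tan (u - v))"
      by (simp add: arctan_minus)
    also have "arctan (tan (u - v)) = u - v" using uv by (intro arctan_tan) auto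
    finally show ?thesis .
  qed
  have "g_fun \<alpha> \<gamma> = 1 + 1 / (2 * a) * (- (u - v) - (u + v))"
    unfolding g_fun_def asin atan by (simp add: a_def mult.assoc)
  also have "\<dots> = - (u - a) / a" using a by (simp add: field_simps)
  finally show ?thesis by (simp add: excess_def u_def a_def p_def)
qed

lemma g_fun_zero_iff:
  assumes "0 < \<alpha>" "\<alpha> \<le> 1" "0 < \<gamma>" "\<gamma> < pi / 2"
  shows "g_fun \<alpha> \<gamma> = 0 \<longleftrightarrow> excess \<alpha> \<gamma> = 0"
proof -
  have "0 < sin \<gamma>" using assms by (intro sin_gt_zero) auto
  then show ?thesis using g_fun_eq[OF assms] assms by simp
qed

lemma gamma0_zero: "0 < gamma0" "gamma0 < pi / 2" "excess 1 gamma0 = 0"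
proof -
  \<comment> \<open>For alpha = 1 the quotient is cot (gamma/2), which at pi/3 equals tan (pi/3);
    the arctan can be evaluated exactly there.\<close>
  have "sin (pi / 3) / (1 - cos (pi / 3)) = tan (pi / 3 :: real)"
    by (simp add: tan_def cos_60)
  then have "excess 1 (pi / 3) = pi / 3 - sin (pi / 3)"
    using arctan_tan[of "pi / 3"] by (simp add: excess_def)
  moreover have "sin (pi / 3) < (1::real)"
    using sin_60 real_sqrt_less_iff[of 3 4] by simp
  ultimately have "0 < excess 1 (pi / 3)" using pi_gt3 by simp
  then obtain \<gamma> where \<gamma>: "pi / 3 < \<gamma>" "\<gamma> < pi / 2" "excess 1 \<gamma> = 0"
    using excess_zero_exists[of 1 "pi / 3"] by auto
  have "0 < gamma0 \<and> gamma0 < pi / 2 \<and> g_fun 1 gamma0 = 0"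
    unfolding gamma0_def
  proof (rule theI)
    have "0 < \<gamma>" using \<gamma>(1) pi_gt_zero by linarith
    then show "0 < \<gamma> \<and> \<gamma> < pi / 2 \<and> g_fun 1 \<gamma> = 0" using \<gamma> by (simp add: g_fun_zero_iff)
    fix \<gamma>2 :: real assume "0 < \<gamma>2 \<and> \<gamma>2 < pi / 2 \<and> g_fun 1 \<gamma>2 = 0"
    then show "\<gamma>2 = \<gamma>"
      using excess_crossing[of 1 \<gamma> \<gamma>2] excess_crossing[of 1 \<gamma>2 \<gamma>] \<gamma> \<open>0 < \<gamma>\<close>
      by (cases \<gamma>2 \<gamma> rule: linorder_cases) (auto simp: g_fun_zero_iff)
  qed
  then show "0 < gamma0" "gamma0 < pi / 2" "excess 1 gamma0 = 0"
    using g_fun_zero_iff[of 1 gamma0] by auto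
qed

text \<open>At the angle \<open>gamma0\<close> the excess vanishes for alpha = 0 and, by the choice
  of \<open>gamma0\<close>, for alpha = 1. In between it rises until alpha = 2 cos gamma0 and falls
  afterwards, so it is positive. This puts a zero between \<open>gamma0\<close> and pi/2.\<close>

lemma excess_gamma0_pos:
  assumes "0 < \<alpha>" "\<alpha> < 1"
  shows "0 < excess \<alpha> gamma0"
proof -
  note g0 = gamma0_zero
  have s: "0 < sin gamma0" using g0 by (intro sin_gt_zero) auto
  have cos_1: "t * cos gamma0 < 1" if "0 \<le> t" "t \<le> 1" for t
    using mult_cos_less_1[of t gamma0] that g0 by simp
  have sq: "0 < (1 - t * cos gamma0)\<^sup>2 + (t * sin gamma0)\<^sup>2" if "0 \<le> t" "t \<le> 1" for t
    using cos_1[OF that] by (simp add: sum_power2_gt_zero_iff)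
  define D where "D t = t * sin gamma0 * (2 * cos gamma0 - t) / ((1 - t * cos gamma0)\<^sup>2 + (t * sin gamma0)\<^sup>2)" for t
  have deriv: "((\<lambda>t. excess t gamma0) has_real_derivative D t) (at t)"
    if "0 \<le> t" "t \<le> 1" for t
    unfolding D_def by (rule excess_deriv_alpha[OF cos_1[OF that]])
  have cont: "continuous_on {a..b} (\<lambda>t. excess t gamma0)" if "0 \<le> a" "b \<le> 1" for a b
  proof -
    have "isCont (\<lambda>t. excess t gamma0) t" if "t \<in> {a..b}" for t
      using that deriv[of t] \<open>0 \<le> a\<close> \<open>b \<le> 1\<close> by (auto intro: DERIV_isCont)
    then show ?thesis by (simp add: continuous_at_imp_continuous_on)
  qed
  show ?thesis
  proof (cases "\<alpha> \<le> 2 * cos gamma0")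
    case True
    have "excess 0 gamma0 < excess \<alpha> gamma0"
    proof (rule DERIV_pos_imp_increasing_open[OF assms(1) _ cont])
      fix t assume t: "0 < t" "t < \<alpha>"
      show "\<exists>y. ((\<lambda>t. excess t gamma0) has_real_derivative y) (at t) \<and> 0 < y"
        by (intro exI[of _ "D t"] conjI deriv)
          (use sq[of t] s assms t True in \<open>auto simp: D_def intro!: divide_pos_pos mult_pos_pos\<close>)
    qed (use assms in auto)
    then show ?thesis by (simp add: excess_def)
  next
    case False
    have "excess \<alpha> gamma0 > excess 1 gamma0"
    proof (rule DERIV_neg_imp_decreasing_open[OF assms(2) _ cont])
      fix t assume t: "\<alpha> < t" "t < 1"
      show "\<exists>y. ((\<lambda>t. excess t gamma0) has_real_derivative y) (at t) \<and> y < 0"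
        by (intro exI[of _ "D t"] conjI deriv)
          (use sq[of t] s assms t False in \<open>auto simp: D_def intro!: divide_neg_pos mult_pos_neg mult_pos_pos\<close>)
    qed (use assms in auto)
    then show ?thesis by (simp add: g0)
  qed
qed

lemma gamma'_zero:
  assumes \<alpha>: "0 < \<alpha>" "\<alpha> \<le> 1"
  shows "gamma0 \<le> gamma' \<alpha>" "gamma' \<alpha> < pi / 2" "excess \<alpha> (gamma' \<alpha>) = 0"
proof -
  note g0 = gamma0_zero
  have "gamma0 \<le> gamma' \<alpha> \<and> gamma' \<alpha> < pi / 2 \<and> excess \<alpha> (gamma' \<alpha>) = 0"
  proof (cases "\<alpha> = 1")
    case True
    then show ?thesis using g0 by (simp add: gamma'_def)
  next
    case False
    then have \<alpha>1: "\<alpha> < 1" using \<alpha> by simp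
    obtain \<gamma> where \<gamma>: "gamma0 < \<gamma>" "\<gamma> < pi / 2" "excess \<alpha> \<gamma> = 0"
      using excess_zero_exists[OF \<alpha> g0(1,2) excess_gamma0_pos[OF \<alpha>(1) \<alpha>1]] by auto
    have "gamma0 < gamma' \<alpha> \<and> gamma' \<alpha> < pi / 2 \<and> g_fun \<alpha> (gamma' \<alpha>) = 0"
      unfolding gamma'_def if_not_P[OF False]
    proof (rule theI)
      show "gamma0 < \<gamma> \<and> \<gamma> < pi / 2 \<and> g_fun \<alpha> \<gamma> = 0"
        using \<gamma> g0 \<alpha> by (simp add: g_fun_zero_iff)
      fix \<gamma>2 :: real assume "gamma0 < \<gamma>2 \<and> \<gamma>2 < pi / 2 \<and> g_fun \<alpha> \<gamma>2 = 0"
      then show "\<gamma>2 = \<gamma>"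
        using excess_crossing[OF \<alpha>, of \<gamma> \<gamma>2] excess_crossing[OF \<alpha>, of \<gamma>2 \<gamma>] \<gamma> g0 \<alpha>
        by (cases \<gamma>2 \<gamma> rule: linorder_cases) (auto simp: g_fun_zero_iff)
    qed
    then show ?thesis using g_fun_zero_iff[OF \<alpha>, of "gamma' \<alpha>"] g0 by auto
  qed
  then show "gamma0 \<le> gamma' \<alpha>" "gamma' \<alpha> < pi / 2" "excess \<alpha> (gamma' \<alpha>) = 0" by auto
qed

lemma excess_pos_below_gamma':
  assumes "0 < \<alpha>" "\<alpha> \<le> 1" "0 < \<gamma>" "\<gamma> < gamma' \<alpha>"
  shows "0 < excess \<alpha> \<gamma>"
  using excess_crossing[of \<alpha> \<gamma> "gamma' \<alpha>"] gamma'_zero[of \<alpha>] assms by force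

lemma excess_neg_above_gamma':
  assumes "0 < \<alpha>" "\<alpha> \<le> 1" "gamma' \<alpha> < \<gamma>" "\<gamma> < pi / 2"
  shows "excess \<alpha> \<gamma> < 0"
  using excess_crossing[of \<alpha> "gamma' \<alpha>" \<gamma>] gamma'_zero[of \<alpha>] gamma0_zero assms by force

subsection \<open>Starlike functions and subordination\<close>

lemma starlike_class_Re_pos:
  assumes "f \<in> starlike_class" "norm z < 1"
  shows "0 < Re (zfpf f z)"
proof -
  obtain w where w: "schwarz_function w" "\<And>z. z \<in> unit_disc \<Longrightarrow> zfpf f z = (1 + w z) / (1 - w z)"
    using assms(1) by (auto simp: starlike_class_def subordinate_def)
  have lt: "norm (w z) < 1" using w(1) assms(2) by (auto simp: schwarz_function_def)
  then have ne: "1 - w z \<noteq> 0" by auto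
  have "(1 + w z) / (1 - w z) = (1 + w z) * cnj (1 - w z) / (norm (1 - w z))\<^sup>2"
    using ne by (metis complex_div_cnj complex_norm_square)
  moreover have "Re ((1 + w z) * cnj (1 - w z)) = 1 - (norm (w z))\<^sup>2"
    unfolding cmod_power2 by (simp add: power2_eq_square algebra_simps)
  ultimately have "Re ((1 + w z) / (1 - w z)) = (1 - (norm (w z))\<^sup>2) / (norm (1 - w z))\<^sup>2"
    by (metis Re_divide_of_real of_real_power)
  moreover have "(norm (w z))\<^sup>2 < 1" using lt by (simp add: abs_square_less_1)
  ultimately show ?thesis using w(2)[of z] assms(2) ne by simp
qed

text \<open>Moving \<open>f z\<close> radially towards the origin moves the preimage \<open>z\<close> closer to the origin,
  since \<open>d log \<bar>z\<bar> / d log \<bar>f\<bar> = Re (f / (z f'))\<close> along that path.\<close>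

lemma starlike_local_retraction:
  assumes holf: "f holomorphic_on unit_disc" and a: "a \<in> unit_disc" "a \<noteq> 0"
    and pos: "0 < Re (a * deriv f a / f a)" and \<epsilon>: "0 < \<epsilon>"
  shows "\<exists>\<delta>>0. \<forall>h. 0 < h \<and> h < \<delta> \<longrightarrow>
    (\<exists>z. dist a z < \<epsilon> \<and> norm z \<le> norm a \<and> f z = of_real (1 - h) * f a)"
proof -
  have nz: "f a \<noteq> 0" "deriv f a \<noteq> 0" using pos by auto
  obtain r0 where r0: "0 < r0" "ball a r0 \<subseteq> unit_disc" "inj_on f (ball a r0)"
    using has_complex_derivative_locally_injective[OF holf a(1) _ nz(2)] by auto
  \<comment> \<open>The radius is also cut down to epsilon so that the retracted point stays close
    to \<open>a\<close>.\<close>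
  define U where "U = ball a (min r0 \<epsilon>)"
  have "U \<subseteq> ball a r0" by (auto simp: U_def)
  then have U: "open U" "a \<in> U" "inj_on f U" "f holomorphic_on U"
    using r0 \<epsilon> inj_on_subset[OF r0(3)] holomorphic_on_subset[OF holf] by (auto simp: U_def)
  obtain g where g: "g holomorphic_on f ` U"
      "\<And>z. z \<in> U \<Longrightarrow> deriv f z * deriv g (f z) = 1" "\<And>z. z \<in> U \<Longrightarrow> g (f z) = z"
    using holomorphic_has_inverse[OF U(4,1,3)] by metis
  \<comment> \<open>Openness of the image lets the local inverse \<open>g\<close> be followed along
    the segment from f a towards 0; this path is \<open>h\<close> below.\<close>
  have opn: "open (f ` U)"
    using open_mapping_thm3[OF U(4,1,3)] .
  define h where "h t = g (of_real t * f a)" for t :: real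
  have dg: "(g has_field_derivative 1 / deriv f a) (at (f a))"
  proof -
    have "deriv g (f a) = 1 / deriv f a" using g(2)[OF U(2)] nz by (simp add: field_simps)
    then show ?thesis using holomorphic_derivI[OF g(1) opn, of "f a"] U(2) by simp
  qed
  have h1: "h 1 = a" using g(3)[OF U(2)] by (simp add: h_def)
  define D where "D = f a / deriv f a"
  have dh: "(h has_vector_derivative D) (at 1)"
  proof -
    have "((\<lambda>t. of_real t * f a) has_vector_derivative f a) (at 1)"
      by (auto intro!: derivative_eq_intros)
    then have "((g \<circ> (\<lambda>t. of_real t * f a)) has_vector_derivative f a * (1 / deriv f a)) (at 1)"
      using dg by (intro field_vector_diff_chain_at) auto
    then show ?thesis by (simp add: h_def[abs_def] o_def D_def)
  qed
  have dnorm: "((\<lambda>t. (Re (h t))\<^sup>2 + (Im (h t))\<^sup>2) has_real_derivative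
      2 * (Re a * Re D + Im a * Im D)) (at 1)"
    by (auto intro!: derivative_eq_intros has_field_derivative_Re has_field_derivative_Im dh simp: h1)
  have "0 < 2 * (Re a * Re D + Im a * Im D)"
  proof -
    define I where "I = inverse (a * deriv f a / f a)"
    \<comment> \<open>The velocity D of the path at t = 1 satisfies D cnj a = |a|^2 / (a f'(a) /
      f(a)), and inversion preserves the right half-plane. Hence the modulus drops as t decreases
      from 1.\<close>
    have "D * cnj a = of_real ((norm a)\<^sup>2) * I"
      unfolding complex_norm_square using nz a by (simp add: D_def I_def field_simps)
    then have "Re (D * cnj a) = (norm a)\<^sup>2 * Re I" by simp
    moreover have "0 < Re I"
      unfolding I_def inverse_complex.simps complex.sel using pos
      by (intro divide_pos_pos) (auto intro: add_pos_nonneg)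
    ultimately have "0 < Re (D * cnj a)" using a by simp
    then show ?thesis by (simp add: algebra_simps)
  qed
  from DERIV_pos_inc_left[OF dnorm this] obtain d1 where d1: "0 < d1"
    "\<And>k. 0 < k \<Longrightarrow> k < d1 \<Longrightarrow> (Re (h (1 - k)))\<^sup>2 + (Im (h (1 - k)))\<^sup>2 < (Re a)\<^sup>2 + (Im a)\<^sup>2"
    unfolding h1 by auto
  obtain d2 where d2: "0 < d2" "ball (f a) d2 \<subseteq> f ` U"
    using opn U(2) open_contains_ball by blast
  define \<delta> where "\<delta> = min d1 (d2 / norm (f a))"
  have "\<exists>z. dist a z < \<epsilon> \<and> norm z \<le> norm a \<and> f z = of_real (1 - k) * f a"
    if k: "0 < k" "k < \<delta>" for k
  proof -
    have "dist (f a) (of_real (1 - k) * f a) = k * norm (f a)"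
      using k by (simp add: dist_norm algebra_simps norm_mult)
    also have "\<dots> < d2" using k nz by (simp add: \<delta>_def field_simps)
    finally have "of_real (1 - k) * f a \<in> f ` U" using d2(2) by auto
    then obtain z where z: "z \<in> U" "f z = of_real (1 - k) * f a" by auto
    have "h (1 - k) = z" using g(3)[OF z(1)] z(2) by (simp add: h_def)
    then have "(norm z)\<^sup>2 < (norm a)\<^sup>2" using d1(2)[of k] k by (simp add: \<delta>_def cmod_power2)
    then have "norm z \<le> norm a" using power2_less_imp_less[of "norm z" "norm a"] by auto
    then show ?thesis using z by (auto simp: U_def)
  qed
  moreover have "0 < \<delta>" using d1 d2 nz by (simp add: \<delta>_def)
  ultimately show ?thesis by auto
qed

text \<open>Among the pairs of distinct points of a closed disc with equal values, one of minimal
  modulus of the value would be improved by retracting both points.\<close>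

lemma starlike_inj_on:
  assumes f: "f \<in> class_A" and pos: "\<And>z. z \<in> unit_disc \<Longrightarrow> 0 < Re (zfpf f z)"
  shows "inj_on f unit_disc"
proof (rule ccontr)
  assume "\<not> inj_on f unit_disc"
  then obtain z1 z2 where z12: "z1 \<in> unit_disc" "z2 \<in> unit_disc" "f z1 = f z2" "z1 \<noteq> z2"
    by (auto simp: inj_on_def)
  have holf: "f holomorphic_on unit_disc" and f0: "f 0 = 0" and df0: "deriv f 0 = 1"
    using f by (auto simp: class_A_def)
  have pos': "0 < Re (z * deriv f z / f z)" if "z \<in> unit_disc" "z \<noteq> 0" for z
    using pos[OF that(1)] that(2) by (simp add: zfpf_def)
  have df: "deriv f z \<noteq> 0" if "z \<in> unit_disc" for z
    using pos'[OF that] df0 by (cases "z = 0") auto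
  define R where "R = max (norm z1) (norm z2)"
  have R: "cball 0 R \<subseteq> unit_disc" using z12 by (auto simp: R_def)
  have "\<forall>\<xi>\<in>unit_disc. \<exists>r>0. inj_on f (ball \<xi> r)"
    using has_complex_derivative_locally_injective[OF holf] df by (metis open_ball)
  then obtain \<rho> where \<rho>: "\<And>\<xi>. \<xi> \<in> unit_disc \<Longrightarrow> 0 < \<rho> \<xi>"
      "\<And>\<xi>. \<xi> \<in> unit_disc \<Longrightarrow> inj_on f (ball \<xi> (\<rho> \<xi>))"
    by metis
  \<comment> \<open>An open neighbourhood of the diagonal made of squares of injectivity balls:
    removing it from \<open>E\<close> discards exactly the pairs (a, a) and leaves a compact
    set.\<close>
  define U where "U = (\<Union>\<xi>\<in>unit_disc. ball \<xi> (\<rho> \<xi>) \<times> ball \<xi> (\<rho> \<xi>))"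
  define E where "E = {p \<in> cball 0 R \<times> cball 0 R. f (fst p) - f (snd p) = 0}"
  have contf: "continuous_on (cball 0 R) f"
    using holomorphic_on_imp_continuous_on[OF holf] R continuous_on_subset by blast
  have "closed E"
    unfolding E_def
  proof (rule continuous_closed_preimage_constant)
    show "continuous_on (cball 0 R \<times> cball 0 R) (\<lambda>p. f (fst p) - f (snd p))"
      by (intro continuous_intros continuous_on_compose2[OF contf]) auto
  qed (auto intro: closed_Times)
  then have "compact E"
    using compact_Int_closed[OF compact_Times[OF compact_cball compact_cball], of E 0 R 0 R]
    by (simp add: E_def Int_def conj_ac)
  moreover have "open U" by (auto simp: U_def intro!: open_Times)
  ultimately have "compact (E - U)" by (rule compact_diff)
  have mem: "(a, b) \<in> E - U \<longleftrightarrow> norm a \<le> R \<and> norm b \<le> R \<and> f a = f b \<and> a \<noteq> b" for a b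
  proof -
    have "(a, b) \<notin> U" if "f a = f b" "a \<noteq> b"
      using \<rho>(2) that by (auto simp: U_def inj_on_def)
    moreover have "(a, a) \<in> U" if "norm a \<le> R"
      using \<rho>(1) R that by (force simp: U_def)
    ultimately show ?thesis by (auto simp: E_def)
  qed
  have "E - U \<noteq> {}" using mem[of z1 z2] z12 by (auto simp: R_def)
  moreover have "continuous_on (E - U) (\<lambda>p. norm (f (fst p)))"
    by (intro continuous_intros continuous_on_compose2[OF contf]) (auto simp: E_def)
  ultimately obtain p where p: "p \<in> E - U" "\<And>p'. p' \<in> E - U \<Longrightarrow> norm (f (fst p)) \<le> norm (f (fst p'))"
    using continuous_attains_inf[OF \<open>compact (E - U)\<close>] by blast
  obtain a b where ab: "p = (a, b)" by (cases p)
  have abR: "norm a \<le> R" "norm b \<le> R" "f a = f b" "a \<noteq> b" using p(1) mem[of a b] ab by auto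
  have disc: "a \<in> unit_disc" "b \<in> unit_disc" using abR R by auto
  have zero: "z = 0" if "f z = 0" "z \<in> unit_disc" for z using pos'[of z] that by force
  have nz: "f a \<noteq> 0" using zero[of a] zero[of b] abR disc by auto
  then have "a \<noteq> 0" "b \<noteq> 0" using f0 abR by auto
  \<comment> \<open>Moving each point by less than half their distance keeps the two retracted
    points distinct.\<close>
  have \<epsilon>: "0 < dist a b / 2" using abR by simp
  obtain \<delta>a where \<delta>a: "0 < \<delta>a" "\<And>h. 0 < h \<Longrightarrow> h < \<delta>a \<Longrightarrow>
      \<exists>z. dist a z < dist a b / 2 \<and> norm z \<le> norm a \<and> f z = of_real (1 - h) * f a"
    using starlike_local_retraction[OF holf disc(1) \<open>a \<noteq> 0\<close> pos'[OF disc(1) \<open>a \<noteq> 0\<close>] \<epsilon>] by auto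
  obtain \<delta>b where \<delta>b: "0 < \<delta>b" "\<And>h. 0 < h \<Longrightarrow> h < \<delta>b \<Longrightarrow>
      \<exists>z. dist b z < dist a b / 2 \<and> norm z \<le> norm b \<and> f z = of_real (1 - h) * f b"
    using starlike_local_retraction[OF holf disc(2) \<open>b \<noteq> 0\<close> pos'[OF disc(2) \<open>b \<noteq> 0\<close>] \<epsilon>] by auto
  define h where "h = min (min \<delta>a \<delta>b) 1 / 2"
  have h: "0 < h" "h < \<delta>a" "h < \<delta>b" "h < 1" using \<delta>a(1) \<delta>b(1) by (auto simp: h_def)
  obtain a' where a': "dist a a' < dist a b / 2" "norm a' \<le> norm a" "f a' = of_real (1 - h) * f a"
    using \<delta>a(2)[of h] h by auto
  obtain b' where b': "dist b b' < dist a b / 2" "norm b' \<le> norm b" "f b' = of_real (1 - h) * f b"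
    using \<delta>b(2)[of h] h by auto
  have "a' \<noteq> b'"
    using dist_triangle[of a b a'] a'(1) b'(1) by (auto simp: dist_commute)
  then have "(a', b') \<in> E - U" using mem[of a' b'] a' b' abR by auto
  then have "norm (f a) \<le> norm (f a')" using p(2)[of "(a', b')"] ab by simp
  also have "norm (f a') = (1 - h) * norm (f a)"
    using h by (simp add: a'(3) norm_mult del: of_real_diff)
  finally show False using nz h by (simp add: mult_le_cancel_right1)
qed

text \<open>For p = \<open>zfpf f\<close> the Schwarz function is the Cayley transform (p - 1) / (p
  + 1), since |p - 1| < |p + 1| is the same as Re p > 0.\<close>

lemma starlike_classI:
  assumes f: "f \<in> class_A" and hol: "zfpf f holomorphic_on unit_disc"
    and pos: "\<And>z. z \<in> unit_disc \<Longrightarrow> 0 < Re (zfpf f z)"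
  shows "f \<in> starlike_class"
proof -
  define w where "w z = (zfpf f z - 1) / (zfpf f z + 1)" for z
  have ne: "zfpf f z + 1 \<noteq> 0" if "z \<in> unit_disc" for z
  proof
    assume "zfpf f z + 1 = 0"
    then have "Re (zfpf f z + 1) = 0" by simp
    with pos[OF that] show False by simp
  qed
  have "w holomorphic_on unit_disc"
    unfolding w_def using ne by (intro holomorphic_intros hol) auto
  moreover have "norm (w z) < 1" if "z \<in> unit_disc" for z
  proof -
    have "(norm (zfpf f z - 1))\<^sup>2 < (norm (zfpf f z + 1))\<^sup>2"
      using pos[OF that] unfolding cmod_power2 by (simp add: power2_eq_square algebra_simps)
    then have "norm (zfpf f z - 1) < norm (zfpf f z + 1)"
      by (rule power2_less_imp_less) simp
    then show ?thesis using ne[OF that] by (simp add: w_def norm_divide)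
  qed
  ultimately have "schwarz_function w"
    by (auto simp: schwarz_function_def w_def zfpf_def)
  moreover have "zfpf f z = (1 + w z) / (1 - w z)" if "z \<in> unit_disc" for z
  proof -
    have "1 + w z = 2 * zfpf f z / (zfpf f z + 1)" "1 - w z = 2 / (zfpf f z + 1)"
      using ne[OF that] by (simp_all add: w_def field_simps)
    then show ?thesis using ne[OF that] by simp
  qed
  moreover have "(\<lambda>z. (1 + z) / (1 - z)) holomorphic_on unit_disc"
    by (intro holomorphic_intros) auto
  ultimately show ?thesis
    using f hol starlike_inj_on[OF f pos] by (auto simp: starlike_class_def subordinate_def)
qed

section \<open>Functions with prescribed logarithmic derivative, and the class
  \<open>class_F\<close>\<close>

text \<open>Integrating f'/f = 1/z + q/z gives f(z) = z exp (l z - l 0) with l a primitive of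
  q(z)/z; the quotient is holomorphic because q 0 = 0, and subtracting l 0 normalizes f'(0) to
  1.\<close>

lemma class_A_with_zfpf:
  assumes hol: "q holomorphic_on unit_disc" and q0: "q 0 = 0"
  shows "\<exists>f\<in>class_A. \<forall>z\<in>unit_disc. zfpf f z = 1 + q z"
proof -
  define k where "k z = (if z = 0 then deriv q 0 else q z / z)" for z
  have "k holomorphic_on unit_disc"
    by (rule pole_theorem_open_0[OF hol, of 0]) (auto simp: k_def q0)
  then obtain l where l: "\<And>z. z \<in> unit_disc \<Longrightarrow> (l has_field_derivative k z) (at z within unit_disc)"
    using holomorphic_convex_primitive'[of unit_disc k] by auto
  define f where "f z = z * exp (l z - l 0)" for z
  have df: "(f has_field_derivative exp (l z - l 0) * (1 + z * k z)) (at z)"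
    if "z \<in> unit_disc" for z
  proof -
    have "(l has_field_derivative k z) (at z)"
      using l[OF that] unfolding at_within_open[OF that open_ball] .
    then show ?thesis
      unfolding f_def by (auto intro!: derivative_eq_intros simp: algebra_simps)
  qed
  have "f holomorphic_on unit_disc"
    unfolding holomorphic_on_open[OF open_ball] using df by blast
  moreover have "deriv f 0 = 1" using DERIV_imp_deriv[OF df[of 0]] by simp
  ultimately have "f \<in> class_A" by (simp add: class_A_def f_def)
  moreover have "zfpf f z = 1 + q z" if "z \<in> unit_disc" for z
  proof (cases "z = 0")
    case False
    then have "zfpf f z = 1 + z * k z"
      using DERIV_imp_deriv[OF df[OF that]] by (simp add: zfpf_def f_def)
    then show ?thesis using False by (simp add: k_def)
  qed (simp add: zfpf_def q0)
  ultimately show ?thesis by blast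
qed

lemma one_plus_mult_Re_pos:
  fixes A z :: complex
  assumes "norm A \<le> 1" "norm z < 1"
  shows "0 < Re (1 + A * z)"
proof -
  have "norm (A * z) < 1"
    using assms mult_le_less_imp_less[of "norm A" 1 "norm z" 1] mult_mono[of "norm A" 1 "norm z" "norm z"]
    by (simp add: norm_mult)
  then show ?thesis using abs_Re_le_cmod[of "A * z"] by simp
qed

lemma psi_holomorphic:
  assumes "norm A \<le> 1" "norm B \<le> 1"
  shows "psi A B holomorphic_on unit_disc"
  unfolding psi_def
proof (intro holomorphic_intros)
  fix z :: complex assume "z \<in> unit_disc"
  then have z: "norm z < 1" by simp
  note re = one_plus_mult_Re_pos[OF assms(1) z] one_plus_mult_Re_pos[OF assms(2) z]
  then show ne: "1 + B * z \<noteq> 0" by (metis less_irrefl zero_complex.sel(1))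
  show "(1 + A * z) / (1 + B * z) \<notin> \<real>\<^sub>\<le>\<^sub>0"
  proof
    assume "(1 + A * z) / (1 + B * z) \<in> \<real>\<^sub>\<le>\<^sub>0"
    then obtain t where t: "t \<le> 0" "(1 + A * z) / (1 + B * z) = of_real t"
      by (auto elim!: nonpos_Reals_cases)
    then have "1 + A * z = of_real t * (1 + B * z)" using ne by (simp add: field_simps)
    then have "Re (1 + A * z) = t * Re (1 + B * z)" by simp
    moreover have "t * Re (1 + B * z) \<le> 0" using re t(1) by (intro mult_nonpos_nonneg) auto
    ultimately show False using re by simp
  qed
qed

lemma class_F_extremal:
  assumes "norm A \<le> 1" "norm B \<le> 1"
  shows "\<exists>f\<in>class_F A B. \<forall>z\<in>unit_disc. zfpf f z = 1 + psi A B z"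
proof -
  note hol = psi_holomorphic[OF assms]
  obtain f where f: "f \<in> class_A" "\<And>z. z \<in> unit_disc \<Longrightarrow> zfpf f z = 1 + psi A B z"
    using class_A_with_zfpf[OF hol] by (auto simp: psi_def)
  have "(\<lambda>z. zfpf f z - 1) holomorphic_on unit_disc"
    using hol by (rule holomorphic_transform) (simp add: f(2))
  moreover have "schwarz_function (\<lambda>z. z)" by (simp add: schwarz_function_def)
  ultimately have "f \<in> class_F A B"
    using f hol unfolding class_F_def subordinate_def by (auto intro!: exI[of _ "\<lambda>z. z"])
  then show ?thesis using f(2) by blast
qed

text \<open>The Schwarz lemma applied to the subordinating function: estimates for the whole class
  reduce to estimates of \<open>psi\<close> on closed discs.\<close>

lemma class_F_zfpf:
  assumes "f \<in> class_F A B" "norm z < 1"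
  shows "\<exists>w. norm w \<le> norm z \<and> zfpf f z = 1 + psi A B w"
proof -
  obtain w where w: "schwarz_function w" "\<forall>z\<in>unit_disc. zfpf f z - 1 = psi A B (w z)"
    using assms(1) by (auto simp: class_F_def subordinate_def)
  have "norm (w z) \<le> norm z"
    using w(1) assms(2) by (intro Schwarz_Lemma(1)) (auto simp: schwarz_function_def)
  then show ?thesis using w(2) assms(2) by (intro exI[of _ "w z"]) (auto simp: algebra_simps)
qed

lemma class_F_holomorphic:
  assumes "f \<in> class_F A B"
  shows "f \<in> class_A" "zfpf f holomorphic_on unit_disc"
proof -
  have "(\<lambda>z. zfpf f z - 1) holomorphic_on unit_disc"
    using assms by (simp add: class_F_def subordinate_def)
  then have "(\<lambda>z. (zfpf f z - 1) + 1) holomorphic_on unit_disc"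
    by (rule holomorphic_on_add) simp
  then show "zfpf f holomorphic_on unit_disc" by simp
qed (use assms in \<open>simp add: class_F_def\<close>)

subsection \<open>The radius of starlikeness\<close>

text \<open>The bound is attained at \<open>\<zeta> = - x\<close>. Since \<open>1 - x cos \<gamma> + i x sin \<gamma> = 1 - x exp (- i \<gamma>)\<close> has
  argument \<open>\<beta> = arctan (x sin \<gamma> / (1 - x cos \<gamma>))\<close>, it suffices that its square rotates the quotient
  into the upper half-plane; the relevant imaginary part is bounded below by a multiple of
  \<open>(x - \<bar>\<zeta>\<bar>) (1 - (x + \<bar>\<zeta>\<bar>) cos \<gamma> + x \<bar>\<zeta>\<bar>)\<close>.\<close>

lemma Im_Ln_quotient_gt:
  assumes \<gamma>: "0 < \<gamma>" "\<gamma> < pi" and x: "0 < x" "x \<le> 1" and \<zeta>: "norm \<zeta> < x"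
  shows "- 2 * arctan (x * sin \<gamma> / (1 - x * cos \<gamma>))
    < Im (Ln ((1 + cis \<gamma> * \<zeta>) / (1 + cis (- \<gamma>) * \<zeta>)))"
proof -
  define s c where "s = sin \<gamma>" and "c = cos \<gamma>"
  have s: "0 < s" using \<gamma> by (simp add: s_def sin_gt_zero)
  have sc: "s * s = 1 - c * c"
    unfolding s_def c_def by (metis power2_eq_square sin_squared_eq)
  have c1: "c < 1" using cos_monotone_0_pi[of 0 \<gamma>] \<gamma> by (simp add: c_def)
  define p a where "p = 1 - x * c" and "a = x * s"
  have p: "0 < p" using mult_cos_less_1[of x \<gamma>] x \<gamma> by (simp add: p_def c_def)
  have a: "0 < a" using x s by (simp add: a_def)
  define \<beta> where "\<beta> = arctan (a / p)"
  have \<beta>: "0 < \<beta>" "\<beta> < pi / 2" using p a arctan_ubound by (auto simp: \<beta>_def)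
  define P where "P = p * sqrt (1 + (a / p)\<^sup>2)"
  have P: "0 < P" using p by (simp add: P_def add_pos_nonneg)
  have polar: "Complex p a = of_real P * cis \<beta>"
  proof -
    have "sqrt (1 + (a / p)\<^sup>2) \<noteq> 0"
      by (metis add_pos_nonneg less_irrefl real_sqrt_eq_zero_cancel_iff zero_le_power2 zero_less_one)
    then show ?thesis using p by (simp add: complex_eq_iff P_def \<beta>_def cos_arctan sin_arctan)
  qed
  define n d where "n = 1 + cis \<gamma> * \<zeta>" and "d = 1 + cis (- \<gamma>) * \<zeta>"
  have nd: "0 < Re n" "0 < Re d"
    unfolding n_def d_def using \<zeta> x by (intro one_plus_mult_Re_pos; simp)+
  then have "n \<noteq> 0" "d \<noteq> 0" by auto
  define \<theta> where "\<theta> = Im (Ln (n / d))"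
  have W: "n / d = of_real (norm (n / d)) * cis \<theta>"
    using \<open>n \<noteq> 0\<close> \<open>d \<noteq> 0\<close> exp_Ln[of "n / d"] unfolding exp_eq_polar[of "Ln (n / d)"] \<theta>_def
    by (metis divide_eq_0_iff exp_eq_polar norm_exp_eq_Re)
  have Im_pos: "0 < Im ((Complex p a)\<^sup>2 * (n * cnj d))"
  proof -
    define r \<rho> where "r = Re \<zeta>" and "\<rho> = norm \<zeta>"
    have rho: "0 \<le> \<rho>" "\<rho> < x" "- \<rho> \<le> r"
      using \<zeta> abs_Re_le_cmod[of \<zeta>] by (auto simp: r_def \<rho>_def)
    have "n * cnj d = 1 + 2 * cis \<gamma> * of_real r + (cis \<gamma>)\<^sup>2 * of_real (\<rho>\<^sup>2)"
    proof -
      have "n * cnj d = 1 + cis \<gamma> * (\<zeta> + cnj \<zeta>) + (cis \<gamma>)\<^sup>2 * (\<zeta> * cnj \<zeta>)"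
        by (simp add: n_def d_def cis_cnj power2_eq_square algebra_simps)
      then show ?thesis
        unfolding complex_add_cnj complex_norm_square[symmetric] \<rho>_def r_def by simp
    qed
    then have "Im ((Complex p a)\<^sup>2 * (n * cnj d))
        = 2 * p * a * (1 + 2 * c * r + (c * c - s * s) * \<rho>\<^sup>2) + (p * p - a * a) * (2 * s * r + 2 * s * c * \<rho>\<^sup>2)"
      by (simp add: power2_eq_square s_def c_def algebra_simps)
    also have "\<dots> = 2 * s * (x * (1 - x * c) + r * (1 - x * x) + \<rho>\<^sup>2 * (c - x))"
    proof -
      have "a * a = x * x * (1 - c * c)" by (simp add: a_def sc[symmetric])
      then have "p * p - a * a = 1 - 2 * x * c + x * x * (2 * (c * c) - 1)"
        by (simp add: p_def algebra_simps)
      moreover have "2 * p * a = 2 * s * (x * (1 - x * c))" by (simp add: p_def a_def)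
      moreover have "c * c - s * s = 2 * (c * c) - 1" by (simp add: sc)
      ultimately show ?thesis
        by (simp only:) (simp add: power2_eq_square algebra_simps)
    qed
    finally have eq: "Im ((Complex p a)\<^sup>2 * (n * cnj d))
        = 2 * s * (x * (1 - x * c) + r * (1 - x * x) + \<rho>\<^sup>2 * (c - x))" .
    \<comment> \<open>The expression is affine in \<open>r\<close> with slope 1 - x^2 >= 0, so for a
      given modulus the worst point is the negative real one.\<close>
    have "x * x \<le> 1" using x by (simp add: mult_le_one)
    then have "- \<rho> * (1 - x * x) \<le> r * (1 - x * x)"
      using rho by (intro mult_right_mono) auto
    moreover have "x * (1 - x * c) + - \<rho> * (1 - x * x) + \<rho>\<^sup>2 * (c - x)
        = (x - \<rho>) * ((1 - x) * (1 - \<rho>) + (1 - c) * (x + \<rho>))"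
      by (simp add: power2_eq_square algebra_simps)
    moreover have "0 < (1 - x) * (1 - \<rho>) + (1 - c) * (x + \<rho>)"
    proof (rule add_nonneg_pos)
      show "0 \<le> (1 - x) * (1 - \<rho>)" using rho x by simp
      show "0 < (1 - c) * (x + \<rho>)" using rho x c1 by simp
    qed
    then have "0 < (x - \<rho>) * ((1 - x) * (1 - \<rho>) + (1 - c) * (x + \<rho>))"
      using rho by simp
    ultimately show ?thesis unfolding eq using s by (intro mult_pos_pos) auto
  qed
  have cis_sum: "cis (2 * \<beta> + \<theta>) = (cis \<beta>)\<^sup>2 * cis \<theta>"
    by (simp add: power2_eq_square cis_mult)
  \<comment> \<open>n / d and n cnj d differ by the positive factor |d|^2, so 2 beta + theta is an
    argument of the product just estimated.\<close>
  have "(Complex p a)\<^sup>2 * (n * cnj d) = (Complex p a)\<^sup>2 * (n / d) * of_real ((norm d)\<^sup>2)"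
    unfolding complex_norm_square using \<open>d \<noteq> 0\<close> by simp
  also have "\<dots> = of_real (P\<^sup>2 * norm (n / d) * (norm d)\<^sup>2) * cis (2 * \<beta> + \<theta>)"
    unfolding polar cis_sum by (subst W) (simp add: power_mult_distrib mult_ac)
  finally have "0 < P\<^sup>2 * norm (n / d) * (norm d)\<^sup>2 * sin (2 * \<beta> + \<theta>)"
    using Im_pos by simp
  then have sin_pos: "0 < sin (2 * \<beta> + \<theta>)"
    by (rule zero_less_mult_pos) (use P \<open>n \<noteq> 0\<close> \<open>d \<noteq> 0\<close> in simp)
  have "- pi < \<theta>" unfolding \<theta>_def using \<open>n \<noteq> 0\<close> \<open>d \<noteq> 0\<close> by (intro mpi_less_Im_Ln) simp
  \<comment> \<open>The bounds beta > 0 and theta > -pi give 2 beta + theta > -pi, and on (-pi, 0]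
    the sine is not positive.\<close>
  have "0 < 2 * \<beta> + \<theta>"
  proof (rule ccontr)
    assume "\<not> ?thesis"
    then have "0 \<le> sin (- (2 * \<beta> + \<theta>))" using \<beta> \<open>- pi < \<theta>\<close> by (intro sin_ge_zero) auto
    with sin_pos show False unfolding sin_minus by simp
  qed
  then show ?thesis by (simp add: \<theta>_def \<beta>_def n_def d_def a_def p_def s_def c_def)
qed

text \<open>The law of sines in the triangle 0, 1, x exp(i gamma), with angles gamma at 0 and beta
  at 1: x and \<open>k\<close> are the two sides other than [0, 1], and 1 - x exp(i gamma) = k
  exp(-i beta). The bound beta < pi/2 keeps -2 beta in the principal range.\<close>

lemma Ln_quotient_extremal:
  assumes "0 < \<gamma>" "0 < \<beta>" "\<beta> < pi / 2" "\<beta> + \<gamma> < pi"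
    and x: "x = sin \<beta> / sin (\<beta> + \<gamma>)"
  shows "Ln ((1 - cis \<gamma> * of_real x) / (1 - cis (- \<gamma>) * of_real x)) = - 2 * \<i> * of_real \<beta>"
proof -
  have sin_pos: "0 < sin \<gamma>" "0 < sin (\<beta> + \<gamma>)" using assms by (auto intro!: sin_gt_zero)
  define k where "k = sin \<gamma> / sin (\<beta> + \<gamma>)"
  have k: "k \<noteq> 0" using sin_pos by (simp add: k_def)
  have 1: "1 - cis \<gamma> * of_real x = of_real k * cis (- \<beta>)"
  proof -
    have "sin (\<beta> + \<gamma>) - cos \<gamma> * sin \<beta> = sin \<gamma> * cos \<beta>" by (simp add: sin_add)
    then have "1 - cos \<gamma> * x = k * cos \<beta>"
      using sin_pos by (simp add: x k_def field_simps)
    then show ?thesis by (simp add: complex_eq_iff) (simp add: x k_def)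
  qed
  then have "cnj (1 - cis \<gamma> * of_real x) = cnj (of_real k * cis (- \<beta>))" by simp
  then have 2: "1 - cis (- \<gamma>) * of_real x = of_real k * cis \<beta>" by (simp add: cis_cnj)
  have "(1 - cis \<gamma> * of_real x) / (1 - cis (- \<gamma>) * of_real x) = cis (- \<beta>) / cis \<beta>"
    unfolding 1 2 using k by simp
  also have "\<dots> = exp (- 2 * \<i> * of_real \<beta>)"
    unfolding cis_divide by (simp add: cis_conv_exp mult_ac)
  finally show ?thesis
    using assms by (simp only:) (rule Ln_exp, auto)
qed

text \<open>A - B is the imaginary number 2 i alpha sin gamma, so dividing by it turns the imaginary
  part of the logarithm into the real part of \<open>psi\<close>.\<close>

lemma Re_psi:
  assumes "0 < \<alpha>" "0 < \<gamma>" "\<gamma> < pi"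
  shows "Re (psi (of_real \<alpha> * exp (\<i> * of_real \<gamma>)) (of_real \<alpha> * exp (- \<i> * of_real \<gamma>)) z)
    = Im (Ln ((1 + cis \<gamma> * (of_real \<alpha> * z)) / (1 + cis (- \<gamma>) * (of_real \<alpha> * z)))) / (2 * \<alpha> * sin \<gamma>)"
proof -
  have e: "exp (\<i> * of_real \<gamma>) = cis \<gamma>" "exp (- \<i> * of_real \<gamma>) = cis (- \<gamma>)"
    by (simp_all add: cis_conv_exp)
  have "of_real \<alpha> * cis \<gamma> - of_real \<alpha> * cis (- \<gamma>) = \<i> * of_real (2 * \<alpha> * sin \<gamma>)"
    by (simp add: complex_eq_iff)
  moreover have "1 / (\<i> * X) * L = - \<i> * L / X" for X L :: complex
    by (simp add: divide_inverse)
  ultimately have "psi (of_real \<alpha> * cis \<gamma>) (of_real \<alpha> * cis (- \<gamma>)) z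
      = - \<i> * Ln ((1 + cis \<gamma> * (of_real \<alpha> * z)) / (1 + cis (- \<gamma>) * (of_real \<alpha> * z))) / of_real (2 * \<alpha> * sin \<gamma>)"
    by (simp only: psi_def mult.left_commute[of _ "of_real \<alpha>"] mult.assoc)
  then show ?thesis unfolding e by (simp only: Re_divide_of_real) simp
qed

section \<open>The radius equation and its smallest root\<close>

lemma radius_equation_iff:
  assumes \<gamma>: "0 < \<gamma>" "\<gamma> < pi / 2" and r: "0 < \<alpha> * r" "\<alpha> * r * cos \<gamma> < 1"
    and u: "u = \<alpha> * r * sin \<gamma> / (1 - \<alpha> * r * cos \<gamma>)"
  shows "radius_equation \<alpha> \<gamma> r \<longleftrightarrow> tan (2 * \<alpha> * sin \<gamma>) = 2 * u / (1 - u\<^sup>2)"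
proof -
  define x s c where "x = \<alpha> * r" and "s = sin \<gamma>" and "c = cos \<gamma>"
  have sc: "s * s = 1 - c * c"
    unfolding s_def c_def by (metis power2_eq_square sin_squared_eq)
  have "0 < c" using \<gamma> by (simp add: c_def cos_gt_zero)
  define p a K where "p = 1 - x * c" and "a = x * s" and "K = 1 + 2 * x * c + x * x"
  have p: "0 < p" using r by (simp add: p_def x_def c_def)
  have K: "0 < K" using r \<open>0 < c\<close> by (simp add: K_def x_def[symmetric] add_pos_pos)
  have sin2: "sin (2 * \<gamma>) = 2 * s * c" and cos2: "cos (2 * \<gamma>) = c * c - s * s"
    by (simp_all add: s_def c_def sin_double cos_double power2_eq_square)
  have N: "\<alpha> ^ 4 * r ^ 4 * sin (2 * \<gamma>) + 2 * \<alpha> ^ 3 * r ^ 3 * sin \<gamma> * cos (2 * \<gamma>)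
      - \<alpha>\<^sup>2 * r\<^sup>2 * sin (2 * \<gamma>) - 2 * \<alpha> * r * sin \<gamma> = K * (- 2 * p * a)"
    unfolding sin2 cos2 sc s_def[symmetric] c_def[symmetric] K_def p_def a_def x_def
    by (simp add: power2_eq_square power3_eq_cube power4_eq_xxxx algebra_simps)
  have D: "\<alpha> ^ 4 * r ^ 4 * cos (2 * \<gamma>) - 2 * \<alpha> ^ 3 * r ^ 3 * sin \<gamma> * sin (2 * \<gamma>)
      - \<alpha>\<^sup>2 * r\<^sup>2 * cos (2 * \<gamma>) - \<alpha>\<^sup>2 * r\<^sup>2 + 1 = K * (p * p - a * a)"
  proof -
    have "a * a = x * x * (1 - c * c)" by (simp add: a_def sc[symmetric])
    moreover have "s * sin (2 * \<gamma>) = 2 * c * (1 - c * c)" unfolding sin2 sc[symmetric] by simp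
    then have "2 * \<alpha> ^ 3 * r ^ 3 * sin \<gamma> * sin (2 * \<gamma>) = 2 * x ^ 3 * (2 * c * (1 - c * c))"
      unfolding x_def power_mult_distrib s_def[symmetric] by simp
    moreover have "cos (2 * \<gamma>) = 2 * (c * c) - 1" unfolding cos2 sc by simp
    moreover have "x ^ 4 * (2 * (c * c) - 1) - 2 * x ^ 3 * (2 * c * (1 - c * c))
        - x\<^sup>2 * (2 * (c * c) - 1) - x\<^sup>2 + 1 = K * (p * p - x * x * (1 - c * c))"
      by (simp add: K_def p_def power2_eq_square power3_eq_cube power4_eq_xxxx algebra_simps)
    ultimately show ?thesis by (simp only: x_def power_mult_distrib)
  qed
  have u': "a / p = u" by (simp add: u a_def p_def x_def s_def c_def)
  \<comment> \<open>No case p = a has to be split off: both quotients then have denominator 0 and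
    value 0.\<close>
  have "K * (- 2 * p * a) / (K * (p * p - a * a)) = - (2 * p * a / (p * p - a * a))"
    using K by simp
  also have "2 * p * a / (p * p - a * a) = (p * p * (2 * u)) / (p * p * (1 - u\<^sup>2))"
    using p by (simp add: u'[symmetric] power2_eq_square right_diff_distrib)
  also have "\<dots> = 2 * u / (1 - u\<^sup>2)" using p by simp
  finally show ?thesis unfolding radius_equation_def N D by auto
qed

text \<open>No case distinction is needed: both sides are \<open>0\<close> at \<open>\<beta> = pi / 4\<close>.\<close>

lemma tan_double':
  fixes \<beta> :: real
  assumes "cos \<beta> \<noteq> 0"
  shows "tan (2 * \<beta>) = 2 * tan \<beta> / (1 - (tan \<beta>)\<^sup>2)"
proof -
  have "2 * tan \<beta> / (1 - (tan \<beta>)\<^sup>2)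
      = ((cos \<beta>)\<^sup>2 * (2 * tan \<beta>)) / ((cos \<beta>)\<^sup>2 * (1 - (tan \<beta>)\<^sup>2))"
    using assms by simp
  also have "\<dots> = sin (2 * \<beta>) / cos (2 * \<beta>)"
    unfolding sin_double cos_double
    using assms by (simp add: tan_def power2_eq_square right_diff_distrib mult_ac)
  finally show ?thesis by (simp add: tan_def)
qed

text \<open>This is injectivity of the tangent at the doubled angle 2 arctan u in (0, pi). The value
  0, given to the pole u = 1 by division by zero, is taken at no other positive u.\<close>

lemma two_div_one_minus_square_inj:
  fixes u t :: real
  assumes "0 < u" "0 < t" "2 * u / (1 - u\<^sup>2) = 2 * t / (1 - t\<^sup>2)"
  shows "u = t"
proof (cases "u\<^sup>2 = 1 \<or> t\<^sup>2 = 1")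
  case True
  then have "u\<^sup>2 = 1 \<and> t\<^sup>2 = 1" using assms by auto
  then show ?thesis using assms by (simp add: power2_eq_1_iff)
next
  case False
  then have "u * (1 - t\<^sup>2) = t * (1 - u\<^sup>2)" using assms by (simp add: field_simps)
  then have "(u - t) * (1 + u * t) = 0" by (simp add: power2_eq_square algebra_simps)
  moreover have "0 < 1 + u * t" using assms by (simp add: add_pos_pos)
  ultimately show ?thesis by simp
qed

text \<open>At this point the argument bound reads \<open>- 2 \<alpha> sin \<gamma>\<close>, so \<open>Re (1 + \<psi>)\<close> vanishes.\<close>

definition starlike_radius :: "real \<Rightarrow> real \<Rightarrow> real" where
  "starlike_radius \<alpha> \<gamma> = sin (\<alpha> * sin \<gamma>) / (\<alpha> * sin (\<alpha> * sin \<gamma> + \<gamma>))"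

context
  fixes \<alpha> \<gamma> :: real
  assumes \<alpha>: "0 < \<alpha>" "\<alpha> \<le> 1" and \<gamma>: "0 < \<gamma>" "\<gamma> < pi / 2"
begin

lemma half_angle_bounds:
  shows "0 < sin \<gamma>" "0 < cos \<gamma>" "0 < \<alpha> * sin \<gamma>" "\<alpha> * sin \<gamma> < pi / 2"
    "0 < sin (\<alpha> * sin \<gamma>)" "0 < cos (\<alpha> * sin \<gamma>)" "\<alpha> * sin \<gamma> + \<gamma> < pi" "0 < sin (\<alpha> * sin \<gamma> + \<gamma>)"
proof -
  show s: "0 < sin \<gamma>" and "0 < cos \<gamma>" using \<gamma> by (auto intro: sin_gt_zero cos_gt_zero)
  show b: "0 < \<alpha> * sin \<gamma>" using \<alpha> s by simp
  have "\<alpha> * sin \<gamma> \<le> 1 * 1" using \<alpha> s by (intro mult_mono) auto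
  then show b2: "\<alpha> * sin \<gamma> < pi / 2" using pi_gt3 by simp
  then show "\<alpha> * sin \<gamma> + \<gamma> < pi" using \<gamma> by simp
  then show "0 < sin (\<alpha> * sin \<gamma> + \<gamma>)" using b \<gamma> by (intro sin_gt_zero) auto
  show "0 < sin (\<alpha> * sin \<gamma>)" "0 < cos (\<alpha> * sin \<gamma>)"
    using b b2 by (auto intro: sin_gt_zero cos_gt_zero)
qed

lemma starlike_radius_pos: "0 < starlike_radius \<alpha> \<gamma>"
  unfolding starlike_radius_def
  by (intro divide_pos_pos mult_pos_pos half_angle_bounds \<alpha>)

lemma tan_starlike_radius:
  defines "x \<equiv> \<alpha> * starlike_radius \<alpha> \<gamma>"
  shows "x * cos \<gamma> < 1" "x * sin \<gamma> / (1 - x * cos \<gamma>) = tan (\<alpha> * sin \<gamma>)"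
proof -
  note b = half_angle_bounds
  define \<beta> where "\<beta> = \<alpha> * sin \<gamma>"
  have x: "x = sin \<beta> / sin (\<beta> + \<gamma>)" using \<alpha> by (simp add: x_def starlike_radius_def \<beta>_def)
  have "sin (\<beta> + \<gamma>) - sin \<beta> * cos \<gamma> = cos \<beta> * sin \<gamma>" by (simp add: sin_add)
  then have eq: "1 - x * cos \<gamma> = cos \<beta> * sin \<gamma> / sin (\<beta> + \<gamma>)"
    using b by (simp add: x \<beta>_def field_simps)
  moreover have "0 < cos \<beta> * sin \<gamma> / sin (\<beta> + \<gamma>)" using b by (simp add: \<beta>_def)
  ultimately show "x * cos \<gamma> < 1" by simp
  show "x * sin \<gamma> / (1 - x * cos \<gamma>) = tan (\<alpha> * sin \<gamma>)"
    unfolding eq using b by (simp add: x \<beta>_def tan_def)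
qed

text \<open>A root r below r0 still has alpha r cos gamma < 1, so the equation compares doubled
  tangents of two positive numbers. Injectivity makes these equal, and x sin gamma / (1 - x cos
  gamma) determines x.\<close>

lemma smallest_positive_root_starlike_radius:
  "smallest_positive_root (radius_equation \<alpha> \<gamma>) (starlike_radius \<alpha> \<gamma>)"
proof -
  note b = half_angle_bounds
  define r0 where "r0 = starlike_radius \<alpha> \<gamma>"
  define t where "t = tan (\<alpha> * sin \<gamma>)"
  have t: "0 < t" using b by (simp add: t_def tan_def)
  have r0: "0 < r0" using starlike_radius_pos by (simp add: r0_def)
  have x0: "\<alpha> * r0 * cos \<gamma> < 1" "\<alpha> * r0 * sin \<gamma> / (1 - \<alpha> * r0 * cos \<gamma>) = t"
    using tan_starlike_radius by (simp_all add: r0_def t_def)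
  have tan2: "tan (2 * \<alpha> * sin \<gamma>) = 2 * t / (1 - t\<^sup>2)"
    using tan_double'[of "\<alpha> * sin \<gamma>"] b by (simp add: t_def mult.assoc)
  have "radius_equation \<alpha> \<gamma> r0"
    using radius_equation_iff[OF \<gamma> _ x0(1) x0(2)[symmetric]] tan2 \<alpha> r0 by simp
  moreover have "r0 \<le> r" if r: "0 < r" "radius_equation \<alpha> \<gamma> r" for r
  proof (rule ccontr)
    assume "\<not> r0 \<le> r"
    then have lt: "\<alpha> * r < \<alpha> * r0" using \<alpha> by simp
    then have "\<alpha> * r * cos \<gamma> < \<alpha> * r0 * cos \<gamma>"
      using b by (intro mult_strict_right_mono)
    then have x1: "\<alpha> * r * cos \<gamma> < 1" using x0(1) by linarith
    define u where "u = \<alpha> * r * sin \<gamma> / (1 - \<alpha> * r * cos \<gamma>)"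
    have u: "0 < u" using \<alpha> r b x1 by (simp add: u_def)
    have "2 * u / (1 - u\<^sup>2) = 2 * t / (1 - t\<^sup>2)"
      using radius_equation_iff[OF \<gamma> _ x1 u_def] r \<alpha> tan2 by simp
    then have "u = t" by (rule two_div_one_minus_square_inj[OF u t])
    then have eq: "\<alpha> * r * sin \<gamma> / (1 - \<alpha> * r * cos \<gamma>)
        = \<alpha> * r0 * sin \<gamma> / (1 - \<alpha> * r0 * cos \<gamma>)"
      using x0(2) u_def by simp
    have ne: "1 - \<alpha> * r * cos \<gamma> \<noteq> 0" "1 - \<alpha> * r0 * cos \<gamma> \<noteq> 0" using x0(1) x1 by auto
    have "\<alpha> * r * sin \<gamma> * (1 - \<alpha> * r0 * cos \<gamma>)
        = \<alpha> * r0 * sin \<gamma> * (1 - \<alpha> * r * cos \<gamma>)"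
      using eq unfolding frac_eq_eq[OF ne] .
    then have "sin \<gamma> * (\<alpha> * r) = sin \<gamma> * (\<alpha> * r0)" by (simp add: algebra_simps)
    then show False using b lt by auto
  qed
  ultimately show ?thesis using r0 by (simp add: smallest_positive_root_def r0_def)
qed

text \<open>The excess is a difference of two values of one increasing function of x, the arctan of
  x sin gamma / (1 - x cos gamma), at x = alpha and at x = alpha r0. Its sign is that of 1 -
  r0.\<close>

lemma starlike_radius_le_1_iff: "starlike_radius \<alpha> \<gamma> \<le> 1 \<longleftrightarrow> 0 \<le> excess \<alpha> \<gamma>"
  and starlike_radius_less_1_iff: "starlike_radius \<alpha> \<gamma> < 1 \<longleftrightarrow> 0 < excess \<alpha> \<gamma>"
proof -
  note b = half_angle_bounds
  define x0 where "x0 = \<alpha> * starlike_radius \<alpha> \<gamma>"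
  note x0 = tan_starlike_radius[folded x0_def]
  have x1: "\<alpha> * cos \<gamma> < 1" using mult_cos_less_1[of \<alpha> \<gamma>] \<alpha> \<gamma> by simp
  have atan: "\<alpha> * sin \<gamma> = arctan (tan (\<alpha> * sin \<gamma>))" using b by (simp add: arctan_tan)
  have ex: "excess \<alpha> \<gamma>
      = arctan (\<alpha> * sin \<gamma> / (1 - \<alpha> * cos \<gamma>)) - arctan (x0 * sin \<gamma> / (1 - x0 * cos \<gamma>))"
    unfolding x0(2) using atan by (simp add: excess_def)
  have diff: "\<alpha> * sin \<gamma> / (1 - \<alpha> * cos \<gamma>) - x0 * sin \<gamma> / (1 - x0 * cos \<gamma>)
      = (\<alpha> - x0) * (sin \<gamma> / ((1 - \<alpha> * cos \<gamma>) * (1 - x0 * cos \<gamma>)))"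
    using x1 x0(1) by (simp add: field_simps)
  have pos: "0 < sin \<gamma> / ((1 - \<alpha> * cos \<gamma>) * (1 - x0 * cos \<gamma>))" using b x0(1) x1 by simp
  have "0 \<le> excess \<alpha> \<gamma> \<longleftrightarrow> 0 \<le> \<alpha> - x0"
    unfolding ex diff_ge_0_iff_ge arctan_le_iff
    using pos by (metis diff diff_ge_0_iff_ge zero_le_mult_iff less_le_not_le)
  then show "starlike_radius \<alpha> \<gamma> \<le> 1 \<longleftrightarrow> 0 \<le> excess \<alpha> \<gamma>"
    using \<alpha> by (simp add: x0_def)
  have "0 < excess \<alpha> \<gamma> \<longleftrightarrow> 0 < \<alpha> - x0"
    unfolding ex diff_gt_0_iff_gt arctan_less_iff
    using pos by (metis diff diff_gt_0_iff_gt zero_less_mult_iff less_le_not_le)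
  then show "starlike_radius \<alpha> \<gamma> < 1 \<longleftrightarrow> 0 < excess \<alpha> \<gamma>"
    using \<alpha> by (simp add: x0_def)
qed

section \<open>Starlikeness and sharpness for conjugate parameters A and B\<close>

abbreviation (input) "F_polar \<equiv> class_F (of_real \<alpha> * exp (\<i> * of_real \<gamma>)) (of_real \<alpha> * exp (- \<i> * of_real \<gamma>))"

text \<open>The free bound x serves two ends: x = alpha for the whole disc, x = alpha r0 for the
  disc of radius r0.\<close>

lemma class_F_Re_pos:
  assumes f: "f \<in> F_polar" and z: "norm z < 1"
    and x: "\<alpha> * norm z < x" "0 < x" "x \<le> 1" "arctan (x * sin \<gamma> / (1 - x * cos \<gamma>)) \<le> \<alpha> * sin \<gamma>"
  shows "0 < Re (zfpf f z)"
proof -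
  note b = half_angle_bounds
  obtain w where w: "norm w \<le> norm z"
    "zfpf f z = 1 + psi (of_real \<alpha> * exp (\<i> * of_real \<gamma>)) (of_real \<alpha> * exp (- \<i> * of_real \<gamma>)) w"
    using class_F_zfpf[OF f z] by auto
  define L where "L = Im (Ln ((1 + cis \<gamma> * (of_real \<alpha> * w)) / (1 + cis (- \<gamma>) * (of_real \<alpha> * w))))"
  have "\<alpha> * norm w \<le> \<alpha> * norm z" using w(1) \<alpha> by (intro mult_left_mono) auto
  then have "norm (of_real \<alpha> * w) < x" using x(1) \<alpha>(1) unfolding norm_mult norm_of_real by linarith
  then have "- 2 * arctan (x * sin \<gamma> / (1 - x * cos \<gamma>)) < L"
    unfolding L_def using \<gamma> x by (intro Im_Ln_quotient_gt) auto
  then have "- (2 * \<alpha> * sin \<gamma>) < L" using x(4) by simp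
  then have "- 1 < L / (2 * \<alpha> * sin \<gamma>)" using b by (simp add: pos_less_divide_eq)
  moreover have "Re (zfpf f z) = 1 + L / (2 * \<alpha> * sin \<gamma>)"
    unfolding w(2) plus_complex.sel L_def using Re_psi[of \<alpha> \<gamma> w] \<alpha> \<gamma> by simp
  ultimately show ?thesis by simp
qed

text \<open>The condition on the radius stands inside the existential because
  \<open>radius_sharp\<close> asks for a member of the class even when the critical point lies
  outside the disc.\<close>

lemma class_F_extremal_zero:
  "\<exists>f\<in>F_polar. starlike_radius \<alpha> \<gamma> < 1 \<longrightarrow> Re (zfpf f (- of_real (starlike_radius \<alpha> \<gamma>))) = 0"
proof -
  note b = half_angle_bounds
  define r0 where "r0 = starlike_radius \<alpha> \<gamma>"
  have "norm (of_real \<alpha> * exp (\<i> * of_real \<gamma>)) \<le> 1" "norm (of_real \<alpha> * exp (- \<i> * of_real \<gamma>)) \<le> 1"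
    using \<alpha> by (simp_all add: norm_mult)
  then obtain f where f: "f \<in> F_polar" "\<And>z. z \<in> unit_disc \<Longrightarrow>
      zfpf f z = 1 + psi (of_real \<alpha> * exp (\<i> * of_real \<gamma>)) (of_real \<alpha> * exp (- \<i> * of_real \<gamma>)) z"
    using class_F_extremal by metis
  have "Re (zfpf f (- of_real r0)) = 0" if "r0 < 1"
  proof -
    have r0: "0 < r0" using starlike_radius_pos by (simp add: r0_def)
    have "Ln ((1 - cis \<gamma> * of_real (\<alpha> * r0)) / (1 - cis (- \<gamma>) * of_real (\<alpha> * r0)))
        = - 2 * \<i> * of_real (\<alpha> * sin \<gamma>)"
      using b \<gamma> \<alpha> by (intro Ln_quotient_extremal) (auto simp: r0_def starlike_radius_def)
    then have "Im (Ln ((1 + cis \<gamma> * (of_real \<alpha> * - of_real r0)) / (1 + cis (- \<gamma>) * (of_real \<alpha> * - of_real r0))))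
        = - (2 * \<alpha> * sin \<gamma>)"
      by simp
    then have "Re (psi (of_real \<alpha> * exp (\<i> * of_real \<gamma>)) (of_real \<alpha> * exp (- \<i> * of_real \<gamma>)) (- of_real r0)) = - 1"
      using Re_psi[of \<alpha> \<gamma> "- of_real r0"] \<alpha> \<gamma> b by simp
    then show ?thesis using f(2)[of "- of_real r0"] that r0 by simp
  qed
  then show ?thesis using f(1) by (auto simp: r0_def)
qed

lemma class_F_starlike:
  assumes "excess \<alpha> \<gamma> < 0"
  shows "F_polar \<subseteq> starlike_class"
proof
  fix f assume f: "f \<in> F_polar"
  have "0 < Re (zfpf f z)" if "z \<in> unit_disc" for z
    by (rule class_F_Re_pos[OF f, of z \<alpha>]) (use assms that \<alpha> in \<open>auto simp: excess_def\<close>)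
  then show "f \<in> starlike_class"
    using class_F_holomorphic[OF f] by (intro starlike_classI)
qed

lemma class_F_starlike_univalent_in:
  assumes "0 \<le> excess \<alpha> \<gamma>" "f \<in> F_polar"
  shows "starlike_univalent_in f (starlike_radius \<alpha> \<gamma>)"
  unfolding starlike_univalent_in_def
proof (intro allI impI)
  note b = half_angle_bounds
  define r0 where "r0 = starlike_radius \<alpha> \<gamma>"
  have r0: "0 < r0" "r0 \<le> 1"
    using starlike_radius_pos starlike_radius_le_1_iff assms by (auto simp: r0_def)
  fix z :: complex assume "norm z < starlike_radius \<alpha> \<gamma>"
  then have z: "norm z < r0" by (simp add: r0_def)
  show "0 < Re (zfpf f z)"
  proof (rule class_F_Re_pos[OF assms(2), of z "\<alpha> * r0"])
    show "arctan (\<alpha> * r0 * sin \<gamma> / (1 - \<alpha> * r0 * cos \<gamma>)) \<le> \<alpha> * sin \<gamma>"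
      using tan_starlike_radius(2) b by (simp add: r0_def arctan_tan)
  qed (use z r0 \<alpha> in \<open>auto simp: mult_le_one\<close>)
qed

lemma class_F_radius_sharp: "radius_sharp F_polar (starlike_radius \<alpha> \<gamma>)"
proof -
  define r0 where "r0 = starlike_radius \<alpha> \<gamma>"
  obtain f where f: "f \<in> F_polar" "r0 < 1 \<Longrightarrow> Re (zfpf f (- of_real r0)) = 0"
    using class_F_extremal_zero by (auto simp: r0_def)
  have "\<not> starlike_univalent_in f \<rho>" if "r0 < \<rho>" "\<rho> \<le> 1" for \<rho>
  proof
    assume "starlike_univalent_in f \<rho>"
    moreover have "norm (- of_real r0 :: complex) < \<rho>"
      using that starlike_radius_pos by (simp add: r0_def)
    ultimately have "0 < Re (zfpf f (- of_real r0))" by (simp only: starlike_univalent_in_def)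
    then show False using f(2) that by simp
  qed
  then show ?thesis using f(1) by (auto simp: radius_sharp_def r0_def)
qed

text \<open>This yields sharpness of the threshold angle: the extremal function has a point of the
  disc where the real part vanishes.\<close>

lemma class_F_not_starlike:
  assumes "0 < excess \<alpha> \<gamma>"
  shows "\<not> F_polar \<subseteq> starlike_class"
proof
  assume sub: "F_polar \<subseteq> starlike_class"
  define r0 where "r0 = starlike_radius \<alpha> \<gamma>"
  have r0: "0 < r0" "r0 < 1"
    using starlike_radius_pos starlike_radius_less_1_iff assms by (auto simp: r0_def)
  obtain f where f: "f \<in> F_polar" "Re (zfpf f (- of_real r0)) = 0"
    using class_F_extremal_zero r0 by (auto simp: r0_def)
  have "0 < Re (zfpf f (- of_real r0))"
    using starlike_class_Re_pos[of f "- of_real r0"] sub f(1) r0 by auto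
  then show False using f(2) by simp
qed

end

section \<open>The real case A = -B = alpha\<close>

lemma Re_psi_real:
  assumes "0 < \<alpha>" "1 + of_real \<alpha> * z \<noteq> 0" "1 - of_real \<alpha> * z \<noteq> 0"
  shows "Re (psi (of_real \<alpha>) (- of_real \<alpha>) z)
    = ln (norm (1 + of_real \<alpha> * z) / norm (1 - of_real \<alpha> * z)) / (2 * \<alpha>)"
proof -
  have "psi (of_real \<alpha>) (- of_real \<alpha>) z
      = Ln ((1 + of_real \<alpha> * z) / (1 - of_real \<alpha> * z)) / of_real (2 * \<alpha>)"
    by (simp add: psi_def)
  then have "Re (psi (of_real \<alpha>) (- of_real \<alpha>) z)
      = Re (Ln ((1 + of_real \<alpha> * z) / (1 - of_real \<alpha> * z))) / (2 * \<alpha>)"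
    by (simp only: Re_divide_of_real)
  then show ?thesis using assms by (simp add: norm_divide)
qed

text \<open>Here alpha r0 = tanh alpha, which solves (1 - x) / (1 + x) = exp(-2 alpha).\<close>

lemma real_radius_bounds:
  fixes \<alpha> :: real
  assumes \<alpha>: "0 < \<alpha>"
  defines "r0 \<equiv> (exp (2 * \<alpha>) - 1) / (\<alpha> * (exp (2 * \<alpha>) + 1))"
  shows "0 < r0" "\<alpha> * r0 < 1" "r0 \<le> 1" "ln ((1 - \<alpha> * r0) / (1 + \<alpha> * r0)) = - 2 * \<alpha>"
proof -
  define E where "E = exp (2 * \<alpha>)"
  have E: "1 < E" using \<alpha> by (simp add: E_def)
  have x0: "\<alpha> * r0 = (E - 1) / (E + 1)" using \<alpha> by (simp add: r0_def E_def)
  show "0 < r0" using E \<alpha> unfolding r0_def E_def[symmetric] by (intro divide_pos_pos mult_pos_pos) auto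
  show "\<alpha> * r0 < 1" unfolding x0 using E by simp
  have "1 - \<alpha> * r0 = 2 / (E + 1)" "1 + \<alpha> * r0 = 2 * E / (E + 1)"
    unfolding x0 using E by (simp_all add: field_simps)
  then have "(1 - \<alpha> * r0) / (1 + \<alpha> * r0) = inverse E"
    using E by (simp only:) (simp add: divide_simps)
  then show "ln ((1 - \<alpha> * r0) / (1 + \<alpha> * r0)) = - 2 * \<alpha>" using E by (simp add: ln_inverse E_def)
  \<comment> \<open>This is tanh alpha <= alpha with denominators cleared; the derivative is
    nonnegative by 1 + y <= exp y at y = -2 t.\<close>
  have "1 + 0 - exp (2 * 0) * (1 - 0) \<le> 1 + \<alpha> - exp (2 * \<alpha>) * (1 - \<alpha>)"
  proof (rule DERIV_nonneg_imp_nondecreasing[of 0 \<alpha> "\<lambda>t. 1 + t - exp (2 * t) * (1 - t)"])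
    fix t :: real
    have "((\<lambda>t. 1 + t - exp (2 * t) * (1 - t)) has_real_derivative 1 - exp (2 * t) * (1 - 2 * t)) (at t)"
      by (auto intro!: derivative_eq_intros simp: algebra_simps)
    moreover have "exp (2 * t) * (1 - 2 * t) \<le> exp (2 * t) * exp (- (2 * t))"
      using exp_ge_add_one_self[of "- (2 * t)"] by (intro mult_left_mono) auto
    then have "0 \<le> 1 - exp (2 * t) * (1 - 2 * t)" by (simp add: mult_exp_exp)
    ultimately show "\<exists>y. ((\<lambda>t. 1 + t - exp (2 * t) * (1 - t)) has_real_derivative y) (at t) \<and> 0 \<le> y"
      by blast
  qed (use \<alpha> in simp)
  then have "E - 1 \<le> \<alpha> * (E + 1)" by (simp add: E_def algebra_simps)
  then show "r0 \<le> 1" using E \<alpha> unfolding r0_def E_def[symmetric] by (simp add: divide_le_eq)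
qed

text \<open>A - B is real, so only the modulus of the quotient counts, and the triangle inequality
  bounds it below by (1 - x) / (1 + x) for |alpha w| <= x. The point w = -r0 attains the bound for x
  = alpha r0.\<close>

lemma class_F_real:
  fixes \<alpha> :: real
  assumes \<alpha>: "0 < \<alpha>" "\<alpha> \<le> 1"
  defines "r0 \<equiv> (exp (2 * \<alpha>) - 1) / (\<alpha> * (exp (2 * \<alpha>) + 1))"
  shows "f \<in> class_F (of_real \<alpha>) (- of_real \<alpha>) \<Longrightarrow> starlike_univalent_in f r0"
    and "radius_sharp (class_F (of_real \<alpha>) (- of_real \<alpha>)) r0"
proof -
  note r0 = real_radius_bounds[OF \<alpha>(1), folded r0_def]
  show "starlike_univalent_in f r0" if f: "f \<in> class_F (of_real \<alpha>) (- of_real \<alpha>)"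
    unfolding starlike_univalent_in_def
  proof (intro allI impI)
    fix z :: complex assume z: "norm z < r0"
    then have "norm z < 1" using r0 by simp
    obtain w where w: "norm w \<le> norm z" "zfpf f z = 1 + psi (of_real \<alpha>) (- of_real \<alpha>) w"
      using class_F_zfpf[OF f \<open>norm z < 1\<close>] by auto
    have lt: "norm (of_real \<alpha> * w) < \<alpha> * r0" using w(1) z \<alpha> by (simp add: norm_mult)
    have n: "1 - \<alpha> * r0 < norm (1 + of_real \<alpha> * w)"
      using norm_triangle_ineq2[of 1 "- (of_real \<alpha> * w)"] lt by simp
    have d: "norm (1 - of_real \<alpha> * w) < 1 + \<alpha> * r0"
      using norm_triangle_ineq4[of 1 "of_real \<alpha> * w"] lt by simp
    have d0: "0 < norm (1 - of_real \<alpha> * w)"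
      using norm_triangle_ineq2[of 1 "of_real \<alpha> * w"] lt r0(2) unfolding norm_one by linarith
    have n0: "0 < norm (1 + of_real \<alpha> * w)" using n r0(2) by linarith
    have "(1 - \<alpha> * r0) / (1 + \<alpha> * r0) < norm (1 + of_real \<alpha> * w) / norm (1 - of_real \<alpha> * w)"
      using n d d0 r0(2) by (intro frac_less2) auto
    moreover have "0 < (1 - \<alpha> * r0) / (1 + \<alpha> * r0)"
      using r0(1,2) \<alpha> by (intro divide_pos_pos) (auto simp: add_pos_pos)
    ultimately have "- 2 * \<alpha> < ln (norm (1 + of_real \<alpha> * w) / norm (1 - of_real \<alpha> * w))"
      unfolding r0(4)[symmetric] by simp
    then have "- 1 < Re (psi (of_real \<alpha>) (- of_real \<alpha>) w)"
      using Re_psi_real[of \<alpha> w] \<alpha> n0 d0 by (simp add: pos_less_divide_eq)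
    then show "0 < Re (zfpf f z)" by (simp add: w(2))
  qed
  have "norm (of_real \<alpha> :: complex) \<le> 1" "norm (- of_real \<alpha> :: complex) \<le> 1" using \<alpha> by auto
  then obtain f where f: "f \<in> class_F (of_real \<alpha>) (- of_real \<alpha>)"
      "\<And>z. z \<in> unit_disc \<Longrightarrow> zfpf f z = 1 + psi (of_real \<alpha>) (- of_real \<alpha>) z"
    using class_F_extremal by metis
  have "\<not> starlike_univalent_in f \<rho>" if "r0 < \<rho>" "\<rho> \<le> 1" for \<rho>
  proof
    assume "starlike_univalent_in f \<rho>"
    moreover have "norm (- of_real r0 :: complex) < \<rho>" using that r0 by simp
    ultimately have "0 < Re (zfpf f (- of_real r0))" by (simp only: starlike_univalent_in_def)
    moreover have "1 - of_real \<alpha> * of_real r0 = (of_real (1 - \<alpha> * r0) :: complex)"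
      "1 + of_real \<alpha> * of_real r0 = (of_real (1 + \<alpha> * r0) :: complex)" by simp_all
    moreover have "0 < 1 - \<alpha> * r0" "0 < 1 + \<alpha> * r0" using r0(1,2) \<alpha> by (auto simp: add_pos_pos)
    ultimately show False
      using f(2)[of "- of_real r0"] Re_psi_real[of \<alpha> "- of_real r0"] that r0(1) r0(4) \<alpha>
      by (simp del: of_real_add of_real_diff of_real_mult)
  qed
  then show "radius_sharp (class_F (of_real \<alpha>) (- of_real \<alpha>)) r0"
    using f(1) by (auto simp: radius_sharp_def)
qed

theorem corollary3p3:
  fixes \<alpha> :: real
  assumes "0 < \<alpha>" and "\<alpha> \<le> 1"
  shows "(let F = class_F (of_real \<alpha>) (- of_real \<alpha>);
              r0 = (exp (2 * \<alpha>) - 1) / (\<alpha> * (exp (2 * \<alpha>) + 1))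
          in (\<forall>f\<in>F. starlike_univalent_in f r0) \<and> radius_sharp F r0)
       \<and> (\<forall>\<gamma>. 0 < \<gamma> \<and> \<gamma> \<le> pi / 2 \<longrightarrow>
           (let F = class_F (of_real \<alpha> * exp (\<i> * of_real \<gamma>)) (of_real \<alpha> * exp (- \<i> * of_real \<gamma>))
            in (\<gamma> \<in> {gamma' \<alpha><..<pi / 2} \<longrightarrow> F \<subseteq> starlike_class)
             \<and> (\<gamma> \<in> {0<..<gamma0} \<union> {gamma0<..gamma' \<alpha>} \<longrightarrow>
                  (\<exists>r0. smallest_positive_root (radius_equation \<alpha> \<gamma>) r0
                     \<and> (\<forall>f\<in>F. starlike_univalent_in f r0) \<and> radius_sharp F r0))
             \<and> (\<gamma> < gamma' \<alpha> \<longrightarrow> \<not> F \<subseteq> starlike_class)))"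
proof (unfold Let_def, intro conjI allI impI ballI)
  note g' = gamma'_zero[OF assms]
  fix \<gamma> assume \<gamma>: "0 < \<gamma> \<and> \<gamma> \<le> pi / 2"
  let ?F = "class_F (of_real \<alpha> * exp (\<i> * of_real \<gamma>)) (of_real \<alpha> * exp (- \<i> * of_real \<gamma>))"
  show "?F \<subseteq> starlike_class" if "\<gamma> \<in> {gamma' \<alpha><..<pi / 2}"
    using that \<gamma> excess_neg_above_gamma'[OF assms] by (intro class_F_starlike[OF assms]) auto
  show "\<not> ?F \<subseteq> starlike_class" if "\<gamma> < gamma' \<alpha>"
    using that \<gamma> excess_pos_below_gamma'[OF assms] g'(2) by (intro class_F_not_starlike[OF assms]) auto
  show "\<exists>r0. smallest_positive_root (radius_equation \<alpha> \<gamma>) r0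
      \<and> (\<forall>f\<in>?F. starlike_univalent_in f r0) \<and> radius_sharp ?F r0"
    if "\<gamma> \<in> {0<..<gamma0} \<union> {gamma0<..gamma' \<alpha>}"
  proof -
    have "\<gamma> \<le> gamma' \<alpha>" using that g'(1) by auto
    then have \<gamma>2: "0 < \<gamma>" "\<gamma> < pi / 2" using g'(2) \<gamma> by auto
    \<comment> \<open>At gamma = gamma' the excess is 0 and the radius is exactly 1, so
      \<open>radius_sharp\<close> has no larger radius to refute.\<close>
    have "0 \<le> excess \<alpha> \<gamma>"
      using excess_pos_below_gamma'[OF assms, of \<gamma>] g'(3) \<open>\<gamma> \<le> gamma' \<alpha>\<close> \<gamma>
      by (cases "\<gamma> = gamma' \<alpha>") auto
    then show ?thesis
      using smallest_positive_root_starlike_radius[OF assms \<gamma>2]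
        class_F_starlike_univalent_in[OF assms \<gamma>2] class_F_radius_sharp[OF assms \<gamma>2] by blast
  qed
qed (use class_F_real[OF assms] in auto)

end
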